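(* Let $L$ be a well-defined IPS generator satisfying conditions (i), (ii), (iii), (iv) and (v) of the context. Then, for every translation-invariant probability measure $\nu\in\mathcal{P}_\theta$ the limit $\tilde g_L(\nu)=\lim_{n\uparrow\infty}|\Lambda_n|^{-1}\tilde g^n_L(\nu)$ exists (in $[-\infty,\infty)$), and $\nu\mapsto\tilde g_L(\nu)$ is upper semicontinuous on $\mathcal{P}_\theta$ with respect to the weak topology.
   Context: **Configurations and measures.** Fix integers $d,q\ge1$; $\Omega=\{1,\dots,q\}^{\mathbb{Z}^d}$ carries the product topology and Borel $\sigma$-algebra. $\mathcal{P}_\theta$ is the set of translation-invariant probability measures on $\Omega$, with the weak topology. $\Lambda\Subset\mathbb{Z}^d$ means that $\Lambda$ is a finite nonempty subset; $\Lambda^c=\mathbb{Z}^d\setminus\Lambda$; $o$ is the origin; $\eta_\Lambda$ is the restriction of $\eta$ to $\Lambda$, and $\eta_\Lambda\xi_\Delta$ is concatenation for disjoint $\Lambda,\Delta$. $1_{\eta_\Lambda}$ is the indicator function of $\{\omega:\omega_\Lambda=\eta_\Lambda\}$, $\nu(f)=\int f\,d\nu$, and $\nu(1_{\eta_\Delta}|\eta_\Lambda)=\nu(1_{\eta_\Delta}1_{\eta_\Lambda})/\nu(1_{\eta_\Lambda})$ for disjoint finite $\Delta,\Lambda$. **IPS.** An interacting particle system (IPS) is given by rates $c_\Delta(\eta,\xi_\Delta)\ge0$, $\Delta\Subset\mathbb{Z}^d$, $\xi_\Delta\in\{1,\dots,q\}^\Delta$, continuous in $\eta\in\Omega$, with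 generator $Lf(\eta)=\sum_{\Delta\Subset\mathbb{Z}^d}\sum_{\xi_\Delta}c_\Delta(\eta,\xi_\Delta)[f(\xi_\Delta\eta_{\Delta^c})-f(\eta)]$ (sums only over terms with positive rate). Put $c_\Delta(\eta)=\sum_{\xi_\Delta\ne\eta_\Delta}c_\Delta(\eta,\xi_\Delta)$ and $c_\Delta=\sup_\eta c_\Delta(\eta)$. It is well-defined if it satisfies Liggett's conditions $\sup_x\sum_{\Delta\ni x}c_\Delta<\infty$ and $\sup_x\sum_{u\neq x}\sum_{\Delta\ni x}\sup\{\sum_{\xi_\Delta}|c_\Delta(\eta,\xi_\Delta)-c_\Delta(\zeta,\xi_\Delta)|:\eta_y=\zeta_y\ \forall y\ne u\}<\infty$. **Conditions on $L$.** (i) $L$ is translation invariant: all rates are translation invariant. (ii) Finitely many types of transitions: up to lattice translations, $c_\Delta>0$ for only finitely many $\Delta\Subset\mathbb{Z}^d$. (iii) Uniformly continuous rates: $\lim_{\Lambda\uparrow\mathbb{Z}^d}\sup_{\Delta\ni o}\sup_{\eta,\xi,\sigma}|c_\Delta(\eta_\Lambda\sigma_{\Lambda^c},\xi_\Delta)-c_\Delta(\eta,\xi_\Delta)|=0$. (iv) Strictly positive minimal transition rate: for all $\Delta$ with $c_\Delta>0$, $\inf_{\eta,\xi:\,c_\Delta(\eta,\xi_\Delta)>0}c_\Delta(\eta,\xi_\Delta)>0$. (v) $L$ cannot enter trap states: for all $\eta$, $\Delta$ and $\xi_\Delta$, $c_\Delta(\eta,\xi_\Delta)>0$ implies $c_\Delta(\xi_\Delta\eta_{\Delta^c})>0$.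 **Approximating specific entropy loss.** Let $\Lambda_n=[-2^n+1,2^n-1]^d\cap\mathbb{Z}^d$ and $\tilde\Lambda_n=[-2^n+n,2^n-n]^d\cap\mathbb{Z}^d$. Define $$\tilde g_L^n(\nu)=\sum_{i\in\tilde\Lambda_n}\sum_{\Delta\ni i}\frac{1}{|\Delta\cap\Lambda_n|}\sum_{\xi_\Delta}\int\nu(d\eta)\,c_\Delta(\eta,\xi_\Delta)\log\frac{\nu(1_{\xi_{\Delta\cap\Lambda_n}}|\eta_{\Lambda_n\setminus\Delta})}{\nu(1_{\eta_{\Delta\cap\Lambda_n}}|\eta_{\Lambda_n\setminus\Delta})}\in[-\infty,\infty)$$ (sums over terms with positive rate, $\log 0=-\infty$). *)

theory Defs
  imports "HOL-Probability.Probability"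
begin

section \<open>Configurations\<close>

text \<open>
  The lattice is \<open>int ^ 'd\<close> with \<open>d = CARD('d)\<close>, the local state space is a finite type \<open>'q\<close>.
  A partial configuration \<open>\<xi>\<^sub>\<Delta>\<close> is an extensional function \<open>\<xi> \<in> \<Delta> \<rightarrow>\<^sub>E UNIV\<close>, and the
  concatenation of \<open>\<xi>\<^sub>\<Delta>\<close> with \<open>\<eta>\<close> off \<open>\<Delta>\<close> is \<open>override_on \<eta> \<xi> \<Delta>\<close>.
\<close>

type_synonym 'd site = "int ^ 'd"
type_synonym ('d, 'q) config = "'d site \<Rightarrow> 'q"

definition config_topology :: "('d::finite, 'q::finite) config topology" where
  "config_topology = product_topology (\<lambda>_. discrete_topology UNIV) UNIV"

definition config_borel :: "('d::finite, 'q::finite) config measure" where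
  "config_borel = sigma UNIV {U. openin config_topology U}"

text \<open>If \<open>\<eta>\<close> is extensional on \<open>\<Delta>\<close>, then \<open>shift a \<eta>\<close> is extensional on \<open>a + \<Delta>\<close>.\<close>

definition shift :: "'d::finite site \<Rightarrow> ('d, 'q) config \<Rightarrow> ('d, 'q) config" where
  "shift a \<eta> = (\<lambda>x. \<eta> (x - a))"

section \<open>Translation-invariant measures and the weak topology\<close>

definition inv_measures :: "('d::finite, 'q::finite) config measure set" where
  "inv_measures = {\<nu>. prob_space \<nu> \<and> sets \<nu> = sets config_borel
     \<and> (\<forall>a. distr \<nu> config_borel (shift a) = \<nu>)}"

text \<open>Continuous functions on the compact configuration space are automatically bounded.\<close>

definition weak_topology :: "('d::finite, 'q::finite) config measure topology" where
  "weak_topology = topology_generated_by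
     {{\<nu> \<in> inv_measures. (\<integral>\<eta>. f \<eta> \<partial>\<nu>) \<in> U} | (f :: ('d, 'q) config \<Rightarrow> real) U.
        continuous_map config_topology euclideanreal f \<and> open U}"

definition upper_semicontinuous_map :: "'a topology \<Rightarrow> ('a \<Rightarrow> ereal) \<Rightarrow> bool" where
  "upper_semicontinuous_map X g \<longleftrightarrow> (\<forall>a. openin X {x \<in> topspace X. g x < a})"

section \<open>Interacting particle systems\<close>

text \<open>
  A generator is given by its rates: \<open>c \<Delta> \<eta> \<xi>\<close> is the rate at which \<open>\<eta>\<close> is replaced by
  \<open>\<xi>\<close> on \<open>\<Delta>\<close>. Only finite nonempty \<open>\<Delta>\<close> and \<open>\<xi> \<in> \<Delta> \<rightarrow>\<^sub>E UNIV\<close> are meaningful.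
\<close>

type_synonym ('d, 'q) rates = "'d site set \<Rightarrow> ('d, 'q) config \<Rightarrow> ('d, 'q) config \<Rightarrow> real"

definition ips_rates :: "('d::finite, 'q::finite) rates \<Rightarrow> bool" where
  "ips_rates c \<longleftrightarrow> (\<forall>\<Delta> \<xi>. finite \<Delta> \<longrightarrow> \<Delta> \<noteq> {} \<longrightarrow> \<xi> \<in> \<Delta> \<rightarrow>\<^sub>E UNIV \<longrightarrow>
     (\<forall>\<eta>. 0 \<le> c \<Delta> \<eta> \<xi>) \<and> continuous_map config_topology euclideanreal (\<lambda>\<eta>. c \<Delta> \<eta> \<xi>))"

definition exit_rate :: "('d::finite, 'q::finite) rates \<Rightarrow> 'd site set \<Rightarrow> ('d, 'q) config \<Rightarrow> real" where
  "exit_rate c \<Delta> \<eta> = (\<Sum>\<xi> \<in> (\<Delta> \<rightarrow>\<^sub>E UNIV) - {restrict \<eta> \<Delta>}. c \<Delta> \<eta> \<xi>)"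

definition max_rate :: "('d::finite, 'q::finite) rates \<Rightarrow> 'd site set \<Rightarrow> ennreal" where
  "max_rate c \<Delta> = (SUP \<eta>. ennreal (exit_rate c \<Delta> \<eta>))"

definition liggett_conditions :: "('d::finite, 'q::finite) rates \<Rightarrow> bool" where
  "liggett_conditions c \<longleftrightarrow>
     (SUP x. \<Sum>\<^sub>\<infinity>\<Delta> \<in> {\<Delta>. finite \<Delta> \<and> x \<in> \<Delta>}. max_rate c \<Delta>) < \<infinity> \<and>
     (SUP x. \<Sum>\<^sub>\<infinity>u \<in> - {x}. \<Sum>\<^sub>\<infinity>\<Delta> \<in> {\<Delta>. finite \<Delta> \<and> x \<in> \<Delta>}.
        SUP (\<eta>, \<zeta>) \<in> {(\<eta>, \<zeta>). \<forall>y. y \<noteq> u \<longrightarrow> \<eta> y = \<zeta> y}.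
          ennreal (\<Sum>\<xi> \<in> \<Delta> \<rightarrow>\<^sub>E UNIV. \<bar>c \<Delta> \<eta> \<xi> - c \<Delta> \<zeta> \<xi>\<bar>)) < \<infinity>"

definition well_defined_ips :: "('d::finite, 'q::finite) rates \<Rightarrow> bool" where
  "well_defined_ips c \<longleftrightarrow> ips_rates c \<and> liggett_conditions c"

definition translation_invariant_rates :: "('d::finite, 'q::finite) rates \<Rightarrow> bool" where
  "translation_invariant_rates c \<longleftrightarrow>
     (\<forall>a \<Delta> \<eta> \<xi>. finite \<Delta> \<longrightarrow> \<Delta> \<noteq> {} \<longrightarrow> \<xi> \<in> \<Delta> \<rightarrow>\<^sub>E UNIV \<longrightarrow>
        c ((\<lambda>x. a + x) ` \<Delta>) (shift a \<eta>) (shift a \<xi>) = c \<Delta> \<eta> \<xi>)"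

definition finitely_many_types :: "('d::finite, 'q::finite) rates \<Rightarrow> bool" where
  "finitely_many_types c \<longleftrightarrow>
     (\<exists>\<D>. finite \<D> \<and> (\<forall>\<Delta>. finite \<Delta> \<longrightarrow> \<Delta> \<noteq> {} \<longrightarrow> max_rate c \<Delta> > 0 \<longrightarrow>
        (\<exists>D\<in>\<D>. \<exists>a. \<Delta> = (\<lambda>x. a + x) ` D)))"

definition uniformly_continuous_rates :: "('d::finite, 'q::finite) rates \<Rightarrow> bool" where
  "uniformly_continuous_rates c \<longleftrightarrow>
     ((\<lambda>\<Lambda>. SUP \<Delta> \<in> {\<Delta>. finite \<Delta> \<and> 0 \<in> \<Delta>}. SUP \<eta>. SUP \<sigma>. SUP \<xi> \<in> \<Delta> \<rightarrow>\<^sub>E UNIV.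
         ennreal \<bar>c \<Delta> (override_on \<sigma> \<eta> \<Lambda>) \<xi> - c \<Delta> \<eta> \<xi>\<bar>) \<longlongrightarrow> 0)
       (finite_subsets_at_top UNIV)"

definition positive_minimal_rate :: "('d::finite, 'q::finite) rates \<Rightarrow> bool" where
  "positive_minimal_rate c \<longleftrightarrow>
     (\<forall>\<Delta>. finite \<Delta> \<longrightarrow> \<Delta> \<noteq> {} \<longrightarrow> max_rate c \<Delta> > 0 \<longrightarrow>
        (INF (\<eta>, \<xi>) \<in> {(\<eta>, \<xi>). \<xi> \<in> \<Delta> \<rightarrow>\<^sub>E UNIV \<and> c \<Delta> \<eta> \<xi> > 0}. c \<Delta> \<eta> \<xi>) > 0)"

definition no_entry_to_traps :: "('d::finite, 'q::finite) rates \<Rightarrow> bool" where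
  "no_entry_to_traps c \<longleftrightarrow>
     (\<forall>\<Delta> \<eta> \<xi>. finite \<Delta> \<longrightarrow> \<Delta> \<noteq> {} \<longrightarrow> \<xi> \<in> \<Delta> \<rightarrow>\<^sub>E UNIV \<longrightarrow> c \<Delta> \<eta> \<xi> > 0 \<longrightarrow>
        exit_rate c \<Delta> (override_on \<eta> \<xi> \<Delta>) > 0)"

section \<open>Approximating specific entropy loss\<close>

definition box :: "int \<Rightarrow> 'd::finite site set" where
  "box r = {x. \<forall>k. - r \<le> x $ k \<and> x $ k \<le> r}"

definition Lam :: "nat \<Rightarrow> 'd::finite site set" where
  "Lam n = box (2 ^ n - 1)"

definition Lam_tilde :: "nat \<Rightarrow> 'd::finite site set" where
  "Lam_tilde n = box (2 ^ n - int n)"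

definition elog :: "real \<Rightarrow> ereal" where
  "elog x = (if x > 0 then ereal (ln x) else - \<infinity>)"

definition ereal_integral :: "'a measure \<Rightarrow> ('a \<Rightarrow> ereal) \<Rightarrow> ereal" where
  "ereal_integral M f =
     enn2ereal (\<integral>\<^sup>+x. e2ennreal (f x) \<partial>M) - enn2ereal (\<integral>\<^sup>+x. e2ennreal (- f x) \<partial>M)"

definition cyl_cond_prob ::
  "('d::finite, 'q::finite) config measure \<Rightarrow> 'd site set \<Rightarrow> ('d, 'q) config
     \<Rightarrow> 'd site set \<Rightarrow> ('d, 'q) config \<Rightarrow> real" where
  "cyl_cond_prob \<nu> \<Delta> \<xi> \<Lambda> \<eta> = \<P>(\<omega> in \<nu>. (\<forall>x\<in>\<Delta>. \<omega> x = \<xi> x) \<bar> (\<forall>x\<in>\<Lambda>. \<omega> x = \<eta> x))"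

text \<open>
  Under finitely many types of transitions the sum over \<open>\<Delta>\<close> is finite; the sets \<open>\<Delta>\<close> with
  \<open>max_rate c \<Delta> = 0\<close> left out allow only the trivial transition, whose logarithm is \<open>0\<close>.
  Terms with rate zero vanish because \<open>0 * (- \<infinity>) = 0\<close> in \<^typ>\<open>ereal\<close>. The denominators
  below are positive for \<open>\<nu>\<close>-almost every \<open>\<eta>\<close>, and the positive part of the integrand has
  finite integral.
\<close>

definition entropy_loss_approx ::
  "('d::finite, 'q::finite) rates \<Rightarrow> nat \<Rightarrow> ('d, 'q) config measure \<Rightarrow> ereal" where
  "entropy_loss_approx c n \<nu> =
     (\<Sum>i \<in> Lam_tilde n. \<Sum>\<Delta> \<in> {\<Delta>. finite \<Delta> \<and> i \<in> \<Delta> \<and> max_rate c \<Delta> > 0}.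
        ereal (1 / real (card (\<Delta> \<inter> Lam n))) *
        (\<Sum>\<xi> \<in> \<Delta> \<rightarrow>\<^sub>E UNIV. ereal_integral \<nu> (\<lambda>\<eta>. ereal (c \<Delta> \<eta> \<xi>) *
           elog (cyl_cond_prob \<nu> (\<Delta> \<inter> Lam n) \<xi> (Lam n - \<Delta>) \<eta>
                 / cyl_cond_prob \<nu> (\<Delta> \<inter> Lam n) \<eta> (Lam n - \<Delta>) \<eta>))))"

definition entropy_loss_density ::
  "('d::finite, 'q::finite) rates \<Rightarrow> nat \<Rightarrow> ('d, 'q) config measure \<Rightarrow> ereal" where
  "entropy_loss_density c n \<nu> =
     ereal (1 / real (card (Lam n :: 'd site set))) * entropy_loss_approx c n \<nu>"

definition entropy_loss ::
  "('d::finite, 'q::finite) rates \<Rightarrow> ('d, 'q) config measure \<Rightarrow> ereal" where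
  "entropy_loss c \<nu> = lim (\<lambda>n. entropy_loss_density c n \<nu>)"

end

(*
  By translation invariance the term of a site i and a transition D -> xi equals the term of the
  origin with Lam n replaced by the window W = Lam n - i, and for i in Lam_tilde n these windows
  contain every fixed finite set once n is large. So it suffices that each term at the origin
  converges as W increases to the lattice.

  On a window the term is a finite sum, over patterns w on W, of (mean rate on w) * p log (q / p),
  where p and q are the probabilities of w before and after the transition. If the rate is a local
  function s, the log-sum inequality makes this sum decreasing in W, and p log (q / p) is upper
  semicontinuous in (p, q) as an infimum of linear functions. Since the rates are bounded away
  from 0 where they are positive, a general rate r satisfies s <= r <= (1 + eps) s with s local.
  As p log (q / p) <= q, replacing r by s costs at most eps * B from above and, after scaling by
  1 + eps, from below. Hence the limit is the infimum over eps, s and W of (sum for s) + eps * B,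
  an infimum of upper semicontinuous functions of the measure.
*)

theory Submission
  imports Defs "HOL-Real_Asymp.Real_Asymp"
begin

section \<open>The function $p \log(q/p)$\<close>

text \<open>The obstacle is that p log (q / p) is bounded above by q but has no lower bound, and
  equals -\<infinity> when a transition leads from a charged pattern to a null one. An additive
  error in the rate could be multiplied by arbitrarily negative logarithms. A relative error keeps
  the zeros of the rate and changes a negative term only by a factor, which is why local rates have
  to approximate multiplicatively. The loss on the positive side is charged to q. Overwriting on
  \<open>D\<close> forgets the pattern on \<open>D\<close>, so the masses q, summed over all
  patterns of a window, are at most the number of patterns on \<open>D\<close>. With a bound
  \<open>K\<close> on the rate this gives the constant B =
  \<open>K * card (D \<rightarrow>\<^sub>E UNIV)\<close>, the same for all windows and measures. The
  mean of a nonlocal rate over a pattern changes with the window, so the log-sum inequality does not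
  apply directly; the window sums are instead trapped between monotone ones. The triples
  (\<epsilon>, s, W) of the resulting infimum are chosen without reference to the measure, so one
  formula serves both for the limit and for semicontinuity.\<close>

definition plog :: "real \<Rightarrow> real \<Rightarrow> ereal" where
  "plog p q = ereal p * elog (q / p)"

text \<open>
  Together with \<open>plog_less_imp_tangent\<close> this exhibits \<open>plog\<close> on the closed quadrant as the
  infimum over \<open>t > 0\<close> of the linear functions \<open>(p, q) \<mapsto> t q - p - p ln t\<close>, attained at \<open>t = p / q\<close>
  when \<open>p, q > 0\<close>.
  Superadditivity and upper semicontinuity, boundary included, are read off from this.
\<close>

lemma plog_le:
  assumes "0 \<le> p" "0 \<le> q" "0 < t"
  shows "plog p q \<le> ereal (t * q - p - p * ln t)"
proof -
  consider "p = 0" | "p > 0" "q = 0" | "p > 0" "q > 0"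
    using assms by linarith
  then show ?thesis
  proof cases
    case 1
    then show ?thesis
      using assms by (simp add: plog_def flip: zero_ereal_def)
  next
    case 2
    then show ?thesis
      by (simp add: plog_def elog_def)
  next
    case 3
    have "ln (t * q / p) \<le> t * q / p - 1"
      using 3 assms by (intro ln_le_minus_one) auto
    then have "p * ln (t * q / p) \<le> p * (t * q / p - 1)"
      using 3 by (intro mult_left_mono) auto
    moreover have "ln (t * q / p) = ln t + ln (q / p)"
      using 3 assms by (simp add: ln_mult ln_div)
    ultimately show ?thesis
      using 3 by (simp add: plog_def elog_def algebra_simps)
  qed
qed

lemma plog_less_imp_tangent:
  assumes "0 \<le> p" "0 \<le> q" "plog p q < a"
  obtains t where "0 < t" "ereal (t * q - p - p * ln t) < a"
proof -
  consider "p = 0" | "p > 0" "q = 0" | "p > 0" "q > 0"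
    using assms by linarith
  then show thesis
  proof cases
    case 1
    then have "0 < a"
      using assms(3) by (simp add: plog_def flip: zero_ereal_def)
    then obtain b where b: "0 < b" "ereal b < a"
      using ereal_dense2[of 0 a] by (auto simp flip: zero_ereal_def)
    \<comment> \<open>At p = 0 the linear functions are t q, with infimum 0 as t tends to 0.
      Dividing by \<open>q + 1\<close> instead of \<open>q\<close> includes q = 0.\<close>
    show thesis
    proof
      show "0 < b / (q + 1)"
        using b assms by auto
      have "b / (q + 1) * q - p - p * ln (b / (q + 1)) \<le> b"
        using 1 b assms by (auto simp: field_simps)
      then show "ereal (b / (q + 1) * q - p - p * ln (b / (q + 1))) < a"
        using b(2) by (meson ereal_less_eq(3) le_less_trans)
    qed
  next
    case 2
    from assms(3) have "- \<infinity> < a"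
      by (cases a) auto
    then obtain b where b: "ereal b < a"
      using ereal_dense2[of "-\<infinity>" a] by auto
    \<comment> \<open>At q = 0 the value -p - p ln t is unbounded below as t grows; the witness
      solves -p - p ln t = b.\<close>
    show thesis
    proof
      show "0 < exp (- b / p - 1)" by simp
      show "ereal (exp (- b / p - 1) * q - p - p * ln (exp (- b / p - 1))) < a"
        using b 2 by (simp add: field_simps)
    qed
  next
    case 3
    show thesis
    proof
      show "0 < p / q" using 3 by simp
      have "p / q * q - p - p * ln (p / q) = p * ln (q / p)"
        using 3 by (simp add: ln_div algebra_simps)
      moreover have "plog p q = ereal (p * ln (q / p))"
        using 3 by (simp add: plog_def elog_def)
      ultimately show "ereal (p / q * q - p - p * ln (p / q)) < a"
        using assms(3) by simp
    qed
  qed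
qed

text \<open>The linear bound at t = 1. With no matching lower bound available, all errors below are
  charged to \<open>q\<close>.\<close>

lemma plog_le_right: "0 \<le> p \<Longrightarrow> 0 \<le> q \<Longrightarrow> plog p q \<le> ereal q"
  using plog_le[of p q 1] order_trans[of "plog p q" "ereal (q - p)" "ereal q"] by simp

lemma plog_less_PInf: "0 \<le> p \<Longrightarrow> 0 \<le> q \<Longrightarrow> plog p q < \<infinity>"
  using plog_le_right[of p q] by (meson ereal_less(4) le_less_trans less_ereal.simps(4))

text \<open>The log-sum inequality: a single t that is nearly optimal for the two totals bounds
  every summand at once, and linear functions add up.\<close>

lemma sum_plog_le:
  assumes "\<And>i. i \<in> I \<Longrightarrow> 0 \<le> p i" "\<And>i. i \<in> I \<Longrightarrow> 0 \<le> q i"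
  shows "(\<Sum>i\<in>I. plog (p i) (q i)) \<le> plog (sum p I) (sum q I)"
proof (rule ccontr)
  assume "\<not> ?thesis"
  then obtain t where t: "0 < t"
    "ereal (t * sum q I - sum p I - sum p I * ln t) < (\<Sum>i\<in>I. plog (p i) (q i))"
    using plog_less_imp_tangent[OF sum_nonneg sum_nonneg, of I p I q] assms not_le by blast
  have "(\<Sum>i\<in>I. plog (p i) (q i)) \<le> (\<Sum>i\<in>I. ereal (t * q i - p i - p i * ln t))"
    using assms t by (intro sum_mono plog_le) auto
  also have "\<dots> = ereal (t * sum q I - sum p I - sum p I * ln t)"
    by (simp add: sum_subtractf sum_distrib_left sum_distrib_right)
  finally show False
    using t(2) by simp
qed

section \<open>Effect of a relative error in the rate on one term\<close>

lemma ereal_squeeze_upper: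
  assumes "0 \<le> s" "s \<le> r" "r \<le> (1 + \<epsilon>) * s" "s \<le> K" "0 \<le> \<epsilon>" "0 \<le> q" "x \<le> ereal q"
  shows "ereal r * x \<le> ereal s * x + ereal (\<epsilon> * (K * q))"
proof (cases x)
  case (real y)
  have "r * y \<le> s * y + \<epsilon> * (K * q)"
  proof (cases "0 \<le> y")
    case True
    have "r * y \<le> (1 + \<epsilon>) * s * y"
      using True assms by (intro mult_right_mono) auto
    moreover have "s * y \<le> K * q"
      using True assms real by (intro mult_mono) auto
    then have "\<epsilon> * (s * y) \<le> \<epsilon> * (K * q)"
      using assms by (intro mult_left_mono) auto
    ultimately show ?thesis
      by (simp add: algebra_simps)
  next
    case False
    have "r * y \<le> s * y"
      using False assms by (intro mult_right_mono_neg) auto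
    moreover have "0 \<le> \<epsilon> * (K * q)"
      using assms by auto
    ultimately show ?thesis by simp
  qed
  then show ?thesis by (simp add: real)
next
  case PInf
  then show ?thesis using assms by simp
next
  case MInf
  have "0 \<le> \<epsilon> * (K * q)"
    using assms by auto
  moreover have "s = 0 \<Longrightarrow> r = 0"
    using assms by auto
  ultimately show ?thesis
    using assms MInf by (cases "s = 0"; cases "r = 0") auto
qed

text \<open>For x < 0 the factor 1 + \<epsilon> is what helps, since (1 + \<epsilon>) s is at least
  r; for x \<ge> 0 the excess \<epsilon> s x is at most \<epsilon> K q. At x = -\<infinity> it
  matters that \<open>s\<close> and \<open>r\<close> vanish together: s = 0 < r would put 0 on the
  left and -\<infinity> on the right.\<close>

lemma ereal_squeeze_lower:
  assumes "0 \<le> s" "s \<le> r" "r \<le> (1 + \<epsilon>) * s" "s \<le> K" "0 \<le> \<epsilon>" "0 \<le> q" "x \<le> ereal q"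
  shows "ereal (1 + \<epsilon>) * (ereal s * x) \<le> ereal r * x + ereal (\<epsilon> * (K * q))"
proof (cases x)
  case (real y)
  have "(1 + \<epsilon>) * (s * y) \<le> r * y + \<epsilon> * (K * q)"
  proof (cases "0 \<le> y")
    case True
    have "s * y \<le> r * y"
      using True assms by (intro mult_right_mono) auto
    moreover have "s * y \<le> K * q"
      using True assms real by (intro mult_mono) auto
    then have "\<epsilon> * (s * y) \<le> \<epsilon> * (K * q)"
      using assms by (intro mult_left_mono) auto
    ultimately show ?thesis
      by (simp add: algebra_simps)
  next
    case False
    have "(1 + \<epsilon>) * s * y \<le> r * y"
      using False assms by (intro mult_right_mono_neg) auto
    moreover have "0 \<le> \<epsilon> * (K * q)"
      using assms by auto
    ultimately show ?thesis by simp
  qed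
  then show ?thesis by (simp add: real)
next
  case PInf
  then show ?thesis using assms by simp
next
  case MInf
  have "0 \<le> \<epsilon> * (K * q)"
    using assms by auto
  moreover have "s = 0 \<Longrightarrow> r = 0"
    using assms by auto
  ultimately show ?thesis
    using assms MInf by (cases "s = 0"; cases "r = 0") auto
qed

section \<open>Finite sums of extended reals that avoid \<infinity> - \<infinity>\<close>

lemma sum_ereal_less_PInf:
  fixes f :: "'a \<Rightarrow> ereal"
  shows "(\<And>i. i \<in> I \<Longrightarrow> f i < \<infinity>) \<Longrightarrow> sum f I < \<infinity>"
  by (simp add: less_top[symmetric] sum_Pinfty top_ereal_def)

lemma ereal_mult_less_PInf: "0 \<le> s \<Longrightarrow> x < \<infinity> \<Longrightarrow> ereal s * x < \<infinity>"
  by (cases x) auto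

text \<open>Finiteness is asked of the \<open>f i\<close> only; the \<open>g i\<close> may be
  infinite, like the negative parts of logarithms to which this is applied.\<close>

lemma sum_ereal_diff:
  fixes f g :: "'a \<Rightarrow> ereal"
  assumes "\<And>i. i \<in> I \<Longrightarrow> 0 \<le> f i" "\<And>i. i \<in> I \<Longrightarrow> f i < \<infinity>" "\<And>i. i \<in> I \<Longrightarrow> 0 \<le> g i"
  shows "sum f I - sum g I = (\<Sum>i\<in>I. f i - g i)"
  using assms
proof (induction I rule: infinite_finite_induct)
  case (insert i I)
  have "0 \<le> sum f I" "0 \<le> sum g I"
    using insert.prems by (auto intro!: sum_nonneg)
  moreover have "sum f I < \<infinity>"
    using insert.prems by (intro sum_ereal_less_PInf) blast
  moreover have "0 \<le> f i" "f i < \<infinity>" "0 \<le> g i"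
    using insert.prems by auto
  moreover have "sum f I - sum g I = (\<Sum>i\<in>I. f i - g i)"
    using insert by auto
  moreover have "f i + x - (g i + y) = (f i - g i) + (x - y)"
    if "0 \<le> f i" "f i < \<infinity>" "0 \<le> g i" "0 \<le> x" "x < \<infinity>" "0 \<le> y" for x y
    using that by (cases "f i"; cases x; cases "g i"; cases y; simp)
  ultimately show ?case
    using insert.hyps by simp
qed auto

section \<open>Upper semicontinuity\<close>

lemma usc_iff_nhd:
  "upper_semicontinuous_map X g \<longleftrightarrow>
    (\<forall>x\<in>topspace X. \<forall>a. g x < a \<longrightarrow> (\<exists>U. openin X U \<and> x \<in> U \<and> (\<forall>y\<in>U. g y < a)))"
  unfolding upper_semicontinuous_map_def
proof (intro iffI allI ballI impI)
  fix x a assume "\<forall>a. openin X {x \<in> topspace X. g x < a}" "x \<in> topspace X" "g x < a"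
  then show "\<exists>U. openin X U \<and> x \<in> U \<and> (\<forall>y\<in>U. g y < a)"
    by (intro exI[of _ "{x \<in> topspace X. g x < a}"]) auto
next
  fix a assume *: "\<forall>x\<in>topspace X. \<forall>a. g x < a \<longrightarrow> (\<exists>U. openin X U \<and> x \<in> U \<and> (\<forall>y\<in>U. g y < a))"
  show "openin X {x \<in> topspace X. g x < a}"
  proof (subst openin_subopen, intro ballI)
    fix x assume "x \<in> {x \<in> topspace X. g x < a}"
    then obtain U where U: "openin X U" "x \<in> U" "\<forall>y\<in>U. g y < a"
      using * by blast
    then show "\<exists>T. openin X T \<and> x \<in> T \<and> T \<subseteq> {x \<in> topspace X. g x < a}"
      using openin_subset[OF U(1)] by (intro exI[of _ U]) blast
  qed
qed

lemma usc_add: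
  assumes f: "upper_semicontinuous_map X f" and g: "upper_semicontinuous_map X g"
    and fin: "\<And>x. x \<in> topspace X \<Longrightarrow> f x < \<infinity>" "\<And>x. x \<in> topspace X \<Longrightarrow> g x < \<infinity>"
  shows "upper_semicontinuous_map X (\<lambda>x. f x + g x)"
  unfolding usc_iff_nhd
proof (intro ballI allI impI)
  fix x a assume x: "x \<in> topspace X" and less: "f x + g x < a"
  \<comment> \<open>The strict inequality is split into one for each summand. If one summand is
    -\<infinity>, its bound can be any real number and absorbs whatever bound the other one
    needs.\<close>
  obtain b c where bc: "f x < b" "g x < c" "b + c \<le> a"
  proof (cases a)
    case PInf
    then show ?thesis using that[of \<infinity> \<infinity>] fin x by auto
  next
    case MInf
    then show ?thesis using less by auto
  next
    case (real r)
    obtain u where u: "f x < ereal u" using fin(1)[OF x] less_PInf_Ex_of_nat by auto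
    obtain v where v: "g x < ereal v" using fin(2)[OF x] less_PInf_Ex_of_nat by auto
    show ?thesis
    proof (cases "f x = -\<infinity> \<or> g x = -\<infinity>")
      case True
      then show ?thesis
        using that[of "ereal (r - v)" "ereal v"] that[of "ereal u" "ereal (r - u)"] u v real by auto
    next
      case False
      then obtain y z where yz: "f x = ereal y" "g x = ereal z"
        using fin[OF x] by (cases "f x"; cases "g x") auto
      have "y + z < r" using less yz real by auto
      then show ?thesis
        using that[of "ereal (y + (r - y - z) / 2)" "ereal (z + (r - y - z) / 2)"] yz real
        by (auto simp: field_simps)
    qed
  qed
  have "openin X {y \<in> topspace X. f y < b}" "openin X {y \<in> topspace X. g y < c}"
    using f g by (auto simp: upper_semicontinuous_map_def)
  then have "openin X ({y \<in> topspace X. f y < b} \<inter> {y \<in> topspace X. g y < c})"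
    by blast
  moreover have "f y + g y < a" if "f y < b" "g y < c" for y
    using ereal_add_strict_mono2[OF that] bc(3) by (rule less_le_trans)
  ultimately show "\<exists>U. openin X U \<and> x \<in> U \<and> (\<forall>y\<in>U. f y + g y < a)"
    using x bc by (intro exI conjI) (assumption, auto)
qed

lemma usc_const: "upper_semicontinuous_map X (\<lambda>x. a)"
  unfolding upper_semicontinuous_map_def
proof
  show "openin X {x \<in> topspace X. a < b}" for b
    by (cases "a < b") auto
qed

lemma usc_cmult:
  assumes "upper_semicontinuous_map X f" "0 \<le> s"
  shows "upper_semicontinuous_map X (\<lambda>x. ereal s * f x)"
proof (cases "s = 0")
  case True
  then show ?thesis by (simp add: usc_const flip: zero_ereal_def)
next
  case False
  then have "ereal s * f x < a \<longleftrightarrow> f x < a / ereal s" for x a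
    using assms(2) ereal_less_divide_pos[of "ereal s" "f x" a] by (simp add: mult.commute)
  then show ?thesis
    using assms(1) by (simp add: upper_semicontinuous_map_def)
qed

lemma usc_sum:
  assumes "\<And>i. i \<in> I \<Longrightarrow> upper_semicontinuous_map X (f i)"
    and "\<And>i x. i \<in> I \<Longrightarrow> x \<in> topspace X \<Longrightarrow> f i x < \<infinity>"
  shows "upper_semicontinuous_map X (\<lambda>x. \<Sum>i\<in>I. f i x)"
  using assms
proof (induction I rule: infinite_finite_induct)
  case (insert i I)
  then show ?case
    by (auto intro!: usc_add sum_ereal_less_PInf)
qed (auto simp: usc_const)

lemma usc_INF:
  assumes "\<And>i. i \<in> I \<Longrightarrow> upper_semicontinuous_map X (f i)"
  shows "upper_semicontinuous_map X (\<lambda>x. INF i\<in>I. f i x)"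
proof -
  have "{x \<in> topspace X. (INF i\<in>I. f i x) < a} = (\<Union>i\<in>I. {x \<in> topspace X. f i x < a})" for a
    by (auto simp: INF_less_iff)
  then show ?thesis
    using assms by (auto simp: upper_semicontinuous_map_def)
qed

lemma usc_plog:
  assumes p: "continuous_map X euclideanreal p" and q: "continuous_map X euclideanreal q"
    and nonneg: "\<And>x. x \<in> topspace X \<Longrightarrow> 0 \<le> p x" "\<And>x. x \<in> topspace X \<Longrightarrow> 0 \<le> q x"
  shows "upper_semicontinuous_map X (\<lambda>x. plog (p x) (q x))"
  unfolding usc_iff_nhd
proof (intro ballI allI impI)
  fix x a assume x: "x \<in> topspace X" and less: "plog (p x) (q x) < a"
  obtain t where t: "0 < t" "ereal (t * q x - p x - p x * ln t) < a"
    using plog_less_imp_tangent[OF nonneg(1)[OF x] nonneg(2)[OF x] less] .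
  let ?l = "\<lambda>y. t * q y - p y - p y * ln t"
  have "continuous_map X euclideanreal ?l"
    by (intro continuous_intros p q)
  moreover have "open {b. ereal b < a}"
    using open_vimage[OF open_lessThan[of a] continuous_on_ereal[OF continuous_on_id]]
    by (simp add: vimage_def)
  ultimately have "openin X {y \<in> topspace X. ?l y \<in> {b. ereal b < a}}"
    by (intro openin_continuous_map_preimage[of X euclideanreal]) (simp_all flip: open_openin)
  moreover have "plog (p y) (q y) < a" if "y \<in> topspace X" "ereal (?l y) < a" for y
    using plog_le[OF nonneg(1)[OF that(1)] nonneg(2)[OF that(1)] t(1)] that(2) by (rule le_less_trans)
  ultimately show "\<exists>U. openin X U \<and> x \<in> U \<and> (\<forall>y\<in>U. plog (p y) (q y) < a)"
    using x t by (intro exI conjI) (assumption, auto)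
qed

section \<open>Cylinders and local rates\<close>

definition cyl :: "'d::finite site set \<Rightarrow> ('d, 'q::finite) config \<Rightarrow> ('d, 'q) config set" where
  "cyl W w = {\<omega>. \<forall>x\<in>W. \<omega> x = w x}"

definition depends_on :: "(('d::finite, 'q::finite) config \<Rightarrow> 'a) \<Rightarrow> 'd site set \<Rightarrow> bool" where
  "depends_on f W \<longleftrightarrow> (\<forall>\<eta> \<zeta>. (\<forall>x\<in>W. \<eta> x = \<zeta> x) \<longrightarrow> f \<eta> = f \<zeta>)"

lemma depends_onD: "depends_on f W \<Longrightarrow> (\<And>x. x \<in> W \<Longrightarrow> \<eta> x = \<zeta> x) \<Longrightarrow> f \<eta> = f \<zeta>"
  by (auto simp: depends_on_def)

lemma topspace_config [simp]: "topspace config_topology = UNIV"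
  by (simp add: config_topology_def)

lemma continuous_map_config_coordinate:
  "continuous_map config_topology (discrete_topology UNIV) (\<lambda>\<omega>. \<omega> x)"
  unfolding config_topology_def
  using continuous_map_product_coordinates[of x UNIV "\<lambda>_. discrete_topology UNIV"] by simp

lemma openin_cyl:
  fixes w :: "('d::finite, 'q::finite) config"
  assumes "finite W"
  shows "openin config_topology (cyl W w)"
  using assms
proof (induction W rule: finite_induct)
  case (insert x W)
  have "openin config_topology {\<omega> \<in> topspace config_topology. \<omega> x \<in> {w x}}"
    by (rule openin_continuous_map_preimage[OF continuous_map_config_coordinate]) simp
  then have "openin config_topology ({\<omega>. \<omega> x = w x} \<inter> cyl W w)"
    using insert.IH by (simp add: openin_Int)
  moreover have "{\<omega>. \<omega> x = w x} \<inter> cyl W w = cyl (insert x W) w"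
    by (auto simp: cyl_def)
  ultimately show ?case by simp
qed (use openin_topspace[of config_topology] in \<open>simp add: cyl_def\<close>)

text \<open>A local event contains the cylinder through each of its points. This yields both the
  measurability of local functions and the continuity of cylinder indicators.\<close>

lemma openin_depends_on:
  fixes A :: "('d::finite, 'q::finite) config set"
  assumes "finite W" "depends_on (\<lambda>\<eta>. \<eta> \<in> A) W"
  shows "openin config_topology A"
proof -
  have "A = (\<Union>\<eta>\<in>A. cyl W \<eta>)"
    using assms(2) unfolding depends_on_def cyl_def by fast
  moreover have "openin config_topology (\<Union>\<eta>\<in>A. cyl W \<eta>)"
    using assms(1) by (intro openin_Union) (auto intro: openin_cyl)
  ultimately show ?thesis by simp
qed

lemma space_config_borel [simp]: "space config_borel = UNIV"
  by (simp add: config_borel_def space_measure_of_conv)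

lemma openin_in_config_borel: "openin config_topology A \<Longrightarrow> A \<in> sets config_borel"
  by (simp add: config_borel_def)

lemma depends_on_measurable:
  fixes f :: "('d::finite, 'q::finite) config \<Rightarrow> 'a::topological_space"
  assumes "finite W" "depends_on f W"
  shows "f \<in> borel_measurable config_borel"
proof (rule borel_measurableI)
  fix S :: "'a set"
  have "depends_on (\<lambda>\<eta>. \<eta> \<in> f -` S \<inter> space config_borel) W"
    using assms(2) by (auto simp: depends_on_def) metis+
  then show "f -` S \<inter> space config_borel \<in> sets config_borel"
    by (intro openin_in_config_borel openin_depends_on[OF assms(1)])
qed

lemma continuous_map_config_measurable:
  fixes f :: "('d::finite, 'q::finite) config \<Rightarrow> real"
  assumes "continuous_map config_topology euclideanreal f"
  shows "f \<in> borel_measurable config_borel"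
proof (rule borel_measurableI)
  fix S :: "real set" assume "open S"
  then have "openin config_topology {\<eta> \<in> topspace config_topology. f \<eta> \<in> S}"
    by (intro openin_continuous_map_preimage[OF assms]) (simp flip: open_openin)
  moreover have "{\<eta> \<in> topspace config_topology. f \<eta> \<in> S} = f -` S \<inter> space config_borel"
    by auto
  ultimately show "f -` S \<inter> space config_borel \<in> sets config_borel"
    by (metis openin_in_config_borel)
qed

lemma shift_measurable: "shift a \<in> measurable config_borel config_borel"
proof -
  have "continuous_map config_topology config_topology (shift a)"
    unfolding config_topology_def shift_def continuous_map_componentwise_UNIV
    using continuous_map_config_coordinate[unfolded config_topology_def] by blast
  then have "shift a -` U \<inter> space config_borel \<in> sets config_borel" if "openin config_topology U" for U
    using openin_continuous_map_preimage[of config_topology config_topology "shift a" U] that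
    by (auto simp: vimage_def intro: openin_in_config_borel)
  then have "shift a \<in> measurable config_borel (sigma UNIV {U. openin config_topology U})"
    by (intro measurable_measure_of) auto
  then show ?thesis
    by (simp add: config_borel_def)
qed

section \<open>Sums over the patterns on a window\<close>

lemma cyl_in_sets: "finite W \<Longrightarrow> cyl W w \<in> sets config_borel"
  by (intro openin_in_config_borel openin_cyl)

lemma finite_PiE_UNIV: "finite W \<Longrightarrow> finite (W \<rightarrow>\<^sub>E (UNIV :: 'q::finite set))"
  by (intro finite_PiE) auto

text \<open>The cylinders of the extensions of \<open>w\<close> partition that of \<open>w\<close>,
  even after overwriting: as \<open>D\<close> lies in \<open>W\<close>, the coordinates in
  \<open>W' - W\<close> that tell extensions apart stay untouched. The case D = {} covers the
  probabilities before the transition.\<close>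

lemma measure_cyl_refine:
  fixes w \<xi> :: "('d::finite, 'q::finite) config"
  assumes \<nu>: "prob_space \<nu>" "sets \<nu> = sets config_borel"
    and W: "finite W'" "W \<subseteq> W'" "D \<subseteq> W" and w: "w \<in> W \<rightarrow>\<^sub>E UNIV"
  shows "(\<Sum>w' \<in> {w' \<in> W' \<rightarrow>\<^sub>E UNIV. restrict w' W = w}. measure \<nu> (cyl W' (override_on w' \<xi> D)))
    = measure \<nu> (cyl W (override_on w \<xi> D))"
proof -
  interpret prob_space \<nu> by fact
  let ?I = "{w' \<in> W' \<rightarrow>\<^sub>E UNIV. restrict w' W = w}"
  let ?A = "\<lambda>w'. cyl W' (override_on w' \<xi> D)"
  have disj: "disjoint_family_on ?A ?I"
    unfolding disjoint_family_on_def
  proof (intro ballI impI)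
    fix u v assume u: "u \<in> ?I" and v: "v \<in> ?I" and "u \<noteq> v"
    have "u = v" if "\<omega> \<in> ?A u" "\<omega> \<in> ?A v" for \<omega>
    proof (rule PiE_ext)
      show "u \<in> W' \<rightarrow>\<^sub>E UNIV" "v \<in> W' \<rightarrow>\<^sub>E UNIV" using u v by auto
      fix x assume x: "x \<in> W'"
      show "u x = v x"
      proof (cases "x \<in> W")
        case True
        have "restrict u W x = restrict v W x" using u v by simp
        then show ?thesis using True by simp
      next
        case False
        then have "x \<notin> D" using W by auto
        then have "\<omega> x = u x" "\<omega> x = v x" using that x by (auto simp: cyl_def)
        then show ?thesis by simp
      qed
    qed
    then show "?A u \<inter> ?A v = {}" using \<open>u \<noteq> v\<close> by auto
  qed
  have "cyl W (override_on w \<xi> D) = (\<Union>w'\<in>?I. ?A w')"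
  proof (intro equalityI subsetI)
    fix \<omega> assume \<omega>: "\<omega> \<in> cyl W (override_on w \<xi> D)"
    \<comment> \<open>On \<open>D\<close> the configuration shows \<open>\<xi>\<close>, not
      \<open>w\<close>; putting \<open>w\<close> back there recovers the extension whose overwritten
      cylinder contains it.\<close>
    let ?w = "restrict (override_on \<omega> w D) W'"
    have "restrict ?w W = w"
    proof
      show "restrict ?w W x = w x" for x
        using \<omega> W PiE_arb[OF w, of x]
        by (cases "x \<in> W"; cases "x \<in> D") (auto simp: cyl_def)
    qed
    then have "?w \<in> ?I" by simp
    moreover have "\<omega> \<in> ?A ?w"
      using \<omega> W by (auto simp: cyl_def override_on_def)
    ultimately show "\<omega> \<in> (\<Union>w'\<in>?I. ?A w')" by blast
  next
    fix \<omega> assume "\<omega> \<in> (\<Union>w'\<in>?I. ?A w')"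
    then show "\<omega> \<in> cyl W (override_on w \<xi> D)"
      using W by (auto simp: cyl_def override_on_def)
  qed
  moreover have "finite ?I"
    by (rule finite_subset[OF _ finite_PiE_UNIV[OF W(1)]]) auto
  moreover have "?A ` ?I \<subseteq> sets \<nu>"
    using W(1) by (simp add: image_subset_iff \<nu>(2) cyl_in_sets)
  ultimately show ?thesis
    using disj by (simp add: finite_measure_finite_Union)
qed

text \<open>Patterns that differ only on \<open>D\<close> have the same overwritten cylinder.
  Grouping by the restriction to \<open>D\<close> leaves one probability per pattern on
  \<open>D\<close>, which is the source of the cardinality in the error constant.\<close>

lemma sum_measure_cyl_override_le:
  fixes \<xi> :: "('d::finite, 'q::finite) config"
  assumes \<nu>: "prob_space \<nu>" "sets \<nu> = sets config_borel"
    and W: "finite W" "D \<subseteq> W"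
  shows "(\<Sum>w \<in> W \<rightarrow>\<^sub>E UNIV. measure \<nu> (cyl W (override_on w \<xi> D)))
    \<le> card (D \<rightarrow>\<^sub>E (UNIV :: 'q set))"
proof -
  interpret prob_space \<nu> by fact
  have D: "finite D" using W by (metis finite_subset)
  have "(\<Sum>w \<in> W \<rightarrow>\<^sub>E UNIV. measure \<nu> (cyl W (override_on w \<xi> D))) =
    (\<Sum>u \<in> D \<rightarrow>\<^sub>E UNIV. \<Sum>w \<in> {w \<in> W \<rightarrow>\<^sub>E UNIV. restrict w D = u}. measure \<nu> (cyl W (override_on w \<xi> D)))"
    by (intro sum.group[symmetric] finite_PiE_UNIV W D) auto
  also have "\<dots> = (\<Sum>u \<in> D \<rightarrow>\<^sub>E UNIV. measure \<nu> (cyl D (override_on u \<xi> D)))"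
    by (intro sum.cong refl measure_cyl_refine[OF \<nu>]) (use W in auto)
  also have "\<dots> \<le> (\<Sum>u \<in> D \<rightarrow>\<^sub>E (UNIV :: 'q set). 1)"
    by (intro sum_mono) simp
  finally show ?thesis by simp
qed

text \<open>The weight is read off at the extensional pattern \<open>w\<close>, so \<open>s\<close>
  can be a local rate or the window-dependent \<open>mean_rate \<nu> r W\<close>.\<close>

definition rate_sum ::
  "('d::finite, 'q::finite) config measure \<Rightarrow> 'd site set \<Rightarrow> ('d, 'q) config \<Rightarrow> 'd site set
     \<Rightarrow> (('d, 'q) config \<Rightarrow> real) \<Rightarrow> ereal" where
  "rate_sum \<nu> D \<xi> W s = (\<Sum>w \<in> W \<rightarrow>\<^sub>E UNIV.
     ereal (s w) * plog (measure \<nu> (cyl W w)) (measure \<nu> (cyl W (override_on w \<xi> D))))"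

lemma ereal_mult_sum:
  fixes f :: "'a \<Rightarrow> ereal"
  assumes "0 \<le> s" "\<And>i. i \<in> I \<Longrightarrow> f i < \<infinity>"
  shows "ereal s * sum f I = (\<Sum>i\<in>I. ereal s * f i)"
  using assms(2)
proof (induction I rule: infinite_finite_induct)
  case (insert i I)
  have "f i < \<infinity>" "sum f I < \<infinity>"
    using insert.prems by (blast intro: sum_ereal_less_PInf)+
  then have "ereal s * (f i + sum f I) = ereal s * f i + ereal s * sum f I"
    using assms(1) by (cases "f i"; cases "sum f I"; cases "s = 0") (auto simp: algebra_simps)
  then show ?case
    using insert by simp
qed auto

text \<open>Patterns on \<open>W'\<close> are grouped by their restriction to \<open>W\<close>.
  Locality makes \<open>s\<close> constant on each group, so it can be pulled out before the log-sum
  inequality is applied.\<close>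

lemma rate_sum_antimono:
  fixes s :: "('d::finite, 'q::finite) config \<Rightarrow> real"
  assumes \<nu>: "prob_space \<nu>" "sets \<nu> = sets config_borel"
    and W: "finite W'" "W \<subseteq> W'" "D \<subseteq> W"
    and s: "depends_on s W" "\<And>\<eta>. 0 \<le> s \<eta>"
  shows "rate_sum \<nu> D \<xi> W' s \<le> rate_sum \<nu> D \<xi> W s"
proof -
  let ?p = "\<lambda>W w. measure \<nu> (cyl W w)" and ?q = "\<lambda>W w. measure \<nu> (cyl W (override_on w \<xi> D))"
  have fin: "finite W" using W by (metis finite_subset)
  have "rate_sum \<nu> D \<xi> W' s = (\<Sum>w \<in> W \<rightarrow>\<^sub>E UNIV. \<Sum>w' \<in> {w' \<in> W' \<rightarrow>\<^sub>E UNIV. restrict w' W = w}.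
      ereal (s w') * plog (?p W' w') (?q W' w'))"
    unfolding rate_sum_def by (intro sum.group[symmetric] finite_PiE_UNIV W fin) auto
  also have "\<dots> \<le> (\<Sum>w \<in> W \<rightarrow>\<^sub>E UNIV. ereal (s w) * plog (?p W w) (?q W w))"
  proof (intro sum_mono)
    fix w :: "('d, 'q) config" assume w: "w \<in> W \<rightarrow>\<^sub>E UNIV"
    let ?I = "{w' \<in> W' \<rightarrow>\<^sub>E UNIV. restrict w' W = w}"
    have "s w' = s w" if "w' \<in> ?I" for w'
      using that by (intro depends_onD[OF s(1)]) auto
    then have "(\<Sum>w' \<in> ?I. ereal (s w') * plog (?p W' w') (?q W' w'))
        = (\<Sum>w' \<in> ?I. ereal (s w) * plog (?p W' w') (?q W' w'))"
      by (intro sum.cong) auto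
    also have "\<dots> = ereal (s w) * (\<Sum>w' \<in> ?I. plog (?p W' w') (?q W' w'))"
      using s(2) by (intro ereal_mult_sum[symmetric] plog_less_PInf) auto
    also have "\<dots> \<le> ereal (s w) * plog (\<Sum>w' \<in> ?I. ?p W' w') (\<Sum>w' \<in> ?I. ?q W' w')"
      using s(2) by (intro ereal_mult_left_mono sum_plog_le) auto
    also have "(\<Sum>w' \<in> ?I. ?q W' w') = ?q W w"
      by (rule measure_cyl_refine[OF \<nu> W w])
    also have "(\<Sum>w' \<in> ?I. ?p W' w') = ?p W w"
      using measure_cyl_refine[OF \<nu> W(1,2) empty_subsetI w] by simp
    finally show "(\<Sum>w' \<in> ?I. ereal (s w') * plog (?p W' w') (?q W' w'))
      \<le> ereal (s w) * plog (?p W w) (?q W w)" .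
  qed
  finally show ?thesis by (simp add: rate_sum_def)
qed

text \<open>The bounds are required on charged patterns only: on a null cylinder
  \<open>mean_rate\<close> is the default value 0 of a division by 0 and may fall below
  \<open>s\<close>, but \<open>plog\<close> vanishes there.\<close>

lemma rate_sum_squeeze:
  fixes s r :: "('d::finite, 'q::finite) config \<Rightarrow> real"
  assumes \<nu>: "prob_space \<nu>" "sets \<nu> = sets config_borel"
    and W: "finite W" "D \<subseteq> W"
    and sr: "\<And>w. w \<in> W \<rightarrow>\<^sub>E UNIV \<Longrightarrow> measure \<nu> (cyl W w) > 0 \<Longrightarrow> s w \<le> r w \<and> r w \<le> (1 + \<epsilon>) * s w"
    and s: "\<And>w. 0 \<le> s w" "\<And>w. s w \<le> K" and "0 \<le> \<epsilon>"
  shows "rate_sum \<nu> D \<xi> W r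
      \<le> rate_sum \<nu> D \<xi> W s + ereal (\<epsilon> * (K * card (D \<rightarrow>\<^sub>E (UNIV :: 'q set))))"
    and "ereal (1 + \<epsilon>) * rate_sum \<nu> D \<xi> W s
      \<le> rate_sum \<nu> D \<xi> W r + ereal (\<epsilon> * (K * card (D \<rightarrow>\<^sub>E (UNIV :: 'q set))))"
proof -
  interpret prob_space \<nu> by fact
  let ?p = "\<lambda>w. measure \<nu> (cyl W w)" and ?q = "\<lambda>w. measure \<nu> (cyl W (override_on w \<xi> D))"
  have K: "0 \<le> K" using s[of undefined] by linarith
  have "(\<Sum>w \<in> W \<rightarrow>\<^sub>E UNIV. \<epsilon> * (K * ?q w)) \<le> \<epsilon> * (K * card (D \<rightarrow>\<^sub>E (UNIV :: 'q set)))"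
    using sum_measure_cyl_override_le[OF \<nu> W, of \<xi>] K \<open>0 \<le> \<epsilon>\<close>
    by (simp add: mult_left_mono flip: sum_distrib_left)
  then have err: "(\<Sum>w \<in> W \<rightarrow>\<^sub>E UNIV. ereal (\<epsilon> * (K * ?q w))) \<le> ereal (\<epsilon> * (K * card (D \<rightarrow>\<^sub>E (UNIV :: 'q set))))"
    by simp
  have nonneg: "0 \<le> \<epsilon> * (K * ?q w)" for w
    using K \<open>0 \<le> \<epsilon>\<close> by simp
  have "ereal (r w) * plog (?p w) (?q w) \<le> ereal (s w) * plog (?p w) (?q w) + ereal (\<epsilon> * (K * ?q w))"
    if "w \<in> W \<rightarrow>\<^sub>E UNIV" for w
  proof (cases "?p w = 0")
    case True
    then show ?thesis using nonneg by (simp add: plog_def flip: zero_ereal_def)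
  next
    case False
    then have "?p w > 0" by (simp add: zero_less_measure_iff)
    then show ?thesis
      using sr[OF that] s \<open>0 \<le> \<epsilon>\<close> by (intro ereal_squeeze_upper plog_le_right) auto
  qed
  then have "rate_sum \<nu> D \<xi> W r
      \<le> (\<Sum>w \<in> W \<rightarrow>\<^sub>E UNIV. ereal (s w) * plog (?p w) (?q w) + ereal (\<epsilon> * (K * ?q w)))"
    unfolding rate_sum_def by (rule sum_mono)
  also have "\<dots> = rate_sum \<nu> D \<xi> W s + (\<Sum>w \<in> W \<rightarrow>\<^sub>E UNIV. ereal (\<epsilon> * (K * ?q w)))"
    by (simp only: rate_sum_def sum.distrib)
  also have "\<dots> \<le> rate_sum \<nu> D \<xi> W s + ereal (\<epsilon> * (K * card (D \<rightarrow>\<^sub>E (UNIV :: 'q set))))"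
    by (intro add_left_mono err)
  finally show "rate_sum \<nu> D \<xi> W r
      \<le> rate_sum \<nu> D \<xi> W s + ereal (\<epsilon> * (K * card (D \<rightarrow>\<^sub>E (UNIV :: 'q set))))" .
  have "ereal (1 + \<epsilon>) * (ereal (s w) * plog (?p w) (?q w))
      \<le> ereal (r w) * plog (?p w) (?q w) + ereal (\<epsilon> * (K * ?q w))"
    if "w \<in> W \<rightarrow>\<^sub>E UNIV" for w
  proof (cases "?p w = 0")
    case True
    then show ?thesis using nonneg by (simp add: plog_def flip: zero_ereal_def)
  next
    case False
    then have "?p w > 0" by (simp add: zero_less_measure_iff)
    then show ?thesis
      using sr[OF that] s \<open>0 \<le> \<epsilon>\<close> by (intro ereal_squeeze_lower plog_le_right) auto
  qed
  then have "(\<Sum>w \<in> W \<rightarrow>\<^sub>E UNIV. ereal (1 + \<epsilon>) * (ereal (s w) * plog (?p w) (?q w)))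
    \<le> (\<Sum>w \<in> W \<rightarrow>\<^sub>E UNIV. ereal (r w) * plog (?p w) (?q w) + ereal (\<epsilon> * (K * ?q w)))"
    by (rule sum_mono)
  moreover have "ereal (1 + \<epsilon>) * rate_sum \<nu> D \<xi> W s
      = (\<Sum>w \<in> W \<rightarrow>\<^sub>E UNIV. ereal (1 + \<epsilon>) * (ereal (s w) * plog (?p w) (?q w)))"
    unfolding rate_sum_def using s \<open>0 \<le> \<epsilon>\<close>
    by (intro ereal_mult_sum ereal_mult_less_PInf plog_less_PInf) auto
  moreover have "(\<Sum>w \<in> W \<rightarrow>\<^sub>E UNIV. ereal (r w) * plog (?p w) (?q w) + ereal (\<epsilon> * (K * ?q w)))
    = rate_sum \<nu> D \<xi> W r + (\<Sum>w \<in> W \<rightarrow>\<^sub>E UNIV. ereal (\<epsilon> * (K * ?q w)))"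
    by (simp only: rate_sum_def sum.distrib)
  moreover have "\<dots> \<le> rate_sum \<nu> D \<xi> W r + ereal (\<epsilon> * (K * card (D \<rightarrow>\<^sub>E (UNIV :: 'q set))))"
    by (intro add_left_mono err)
  ultimately show "ereal (1 + \<epsilon>) * rate_sum \<nu> D \<xi> W s
      \<le> rate_sum \<nu> D \<xi> W r + ereal (\<epsilon> * (K * card (D \<rightarrow>\<^sub>E (UNIV :: 'q set))))"
    by (simp only: order_trans)
qed

lemma rate_sum_less_PInf: "(\<And>w. 0 \<le> s w) \<Longrightarrow> rate_sum \<nu> D \<xi> W s < \<infinity>"
  unfolding rate_sum_def
  by (intro sum_ereal_less_PInf ereal_mult_less_PInf plog_less_PInf) auto

section \<open>Cylinder probabilities in the weak topology\<close>

lemma topspace_weak_topology [simp]: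
  "topspace (weak_topology :: ('d::finite, 'q::finite) config measure topology) = inv_measures"
proof -
  have "continuous_map config_topology euclideanreal (\<lambda>_ :: ('d, 'q) config. 0 :: real)"
    by simp
  then show ?thesis
    unfolding weak_topology_def topology_generated_by_topspace
    by (intro equalityI Union_least Union_upper)
      (auto intro!: exI[of _ "\<lambda>_ :: ('d, 'q) config. 0 :: real"] exI[of _ "UNIV :: real set"])
qed

text \<open>The indicator of a cylinder depends on finitely many coordinates, hence is continuous
  and an admissible test function.\<close>

lemma continuous_map_measure_cyl:
  fixes w :: "('d::finite, 'q::finite) config"
  assumes W: "finite W"
  shows "continuous_map weak_topology euclideanreal (\<lambda>\<nu>. measure \<nu> (cyl W w))"
proof -
  let ?f = "indicator (cyl W w) :: ('d, 'q) config \<Rightarrow> real"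
  have "continuous_map config_topology euclideanreal ?f"
    unfolding continuous_map_def
  proof (intro conjI allI impI)
    fix U :: "real set"
    have "depends_on (\<lambda>\<eta>. \<eta> \<in> {x \<in> topspace config_topology. ?f x \<in> U}) W"
      by (auto simp: depends_on_def indicator_def cyl_def)
    then show "openin config_topology {x \<in> topspace config_topology. ?f x \<in> U}"
      by (rule openin_depends_on[OF W])
  qed auto
  then have "openin weak_topology {\<nu> \<in> inv_measures. (\<integral>\<eta>. ?f \<eta> \<partial>\<nu>) \<in> U}" if "open U" for U
    unfolding weak_topology_def using that by (intro topology_generated_by_Basis) blast
  moreover have "(\<integral>\<eta>. ?f \<eta> \<partial>\<nu>) = measure \<nu> (cyl W w)" if "\<nu> \<in> inv_measures" for \<nu>
  proof -
    have "sets \<nu> = sets config_borel" using that by (simp add: inv_measures_def)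
    then have "space \<nu> = UNIV" by (metis sets_eq_imp_space_eq space_config_borel)
    then show ?thesis by simp
  qed
  then have "{\<nu> \<in> inv_measures. (\<integral>\<eta>. ?f \<eta> \<partial>\<nu>) \<in> U} = {\<nu> \<in> topspace weak_topology. measure \<nu> (cyl W w) \<in> U}" for U
    by auto
  ultimately show ?thesis
    by (simp add: continuous_map_def open_openin[symmetric])
qed

lemma usc_rate_sum:
  assumes "finite W" "\<And>w. 0 \<le> s w"
  shows "upper_semicontinuous_map weak_topology (\<lambda>\<nu>. rate_sum \<nu> D \<xi> W s)"
  unfolding rate_sum_def using assms
  by (intro usc_sum usc_cmult usc_plog continuous_map_measure_cyl ereal_mult_less_PInf plog_less_PInf) auto

section \<open>Convergence for a single transition\<close>

text \<open>The relative form of the bound forces \<open>r\<close> and \<open>s\<close> to have the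
  same zeros.\<close>

definition squeeze ::
  "(('d::finite, 'q::finite) config \<Rightarrow> real) \<Rightarrow> real \<Rightarrow> 'd site set \<Rightarrow> (('d, 'q) config \<Rightarrow> real) \<Rightarrow> bool" where
  "squeeze r \<epsilon> V s \<longleftrightarrow> finite V \<and> depends_on s V \<and>
     (\<forall>\<eta>. 0 \<le> s \<eta> \<and> s \<eta> \<le> r \<eta> \<and> r \<eta> \<le> (1 + \<epsilon>) * s \<eta>)"

text \<open>The conditional expectation of \<open>r\<close> given the pattern \<open>w\<close> on
  \<open>W\<close>, with value 0 on null cylinders.\<close>

definition mean_rate ::
  "('d::finite, 'q::finite) config measure \<Rightarrow> (('d, 'q) config \<Rightarrow> real) \<Rightarrow> 'd site set
     \<Rightarrow> ('d, 'q) config \<Rightarrow> real" where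
  "mean_rate \<nu> r W w = (\<integral>\<eta>. indicator (cyl W w) \<eta> * r \<eta> \<partial>\<nu>) / measure \<nu> (cyl W w)"

text \<open>The index set does not mention \<open>\<nu>\<close>, so this is an infimum of a fixed
  family of functions of the measure. The inclusion of \<open>V\<close> in \<open>W\<close> places
  the windows where \<open>rate_sum\<close> decreases.\<close>

definition rate_inf ::
  "('d::finite, 'q::finite) config measure \<Rightarrow> 'd site set \<Rightarrow> ('d, 'q) config
     \<Rightarrow> (('d, 'q) config \<Rightarrow> real) \<Rightarrow> real \<Rightarrow> ereal" where
  "rate_inf \<nu> D \<xi> r B = (INF (\<epsilon>, V, s, W) \<in>
     {(\<epsilon>, V, s, W). 0 < \<epsilon> \<and> squeeze r \<epsilon> V s \<and> finite W \<and> V \<subseteq> W \<and> D \<subseteq> W}.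
     rate_sum \<nu> D \<xi> W s + ereal (\<epsilon> * B))"

lemma usc_rate_inf:
  "upper_semicontinuous_map weak_topology (\<lambda>\<nu>. rate_inf \<nu> D \<xi> r B)"
  unfolding rate_inf_def case_prod_unfold
  by (intro usc_INF usc_add usc_rate_sum usc_const rate_sum_less_PInf) (auto simp: squeeze_def)

lemma rate_inf_less_PInf:
  assumes "finite D" "0 < \<epsilon>" "squeeze r \<epsilon> V s"
  shows "rate_inf \<nu> D \<xi> r B < \<infinity>"
proof -
  have "rate_inf \<nu> D \<xi> r B \<le> rate_sum \<nu> D \<xi> (V \<union> D) s + ereal (\<epsilon> * B)"
    unfolding rate_inf_def using assms
    by (intro INF_lower2[of "(\<epsilon>, V, s, V \<union> D)"]) (auto simp: squeeze_def)
  also have "\<dots> < \<infinity>"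
    using rate_sum_less_PInf[of s \<nu> D \<xi> "V \<union> D"] assms(3) by (auto simp: squeeze_def)
  finally show ?thesis .
qed

lemma indicator_mult_integrable:
  fixes r :: "('d::finite, 'q::finite) config \<Rightarrow> real"
  assumes \<nu>: "prob_space \<nu>" "sets \<nu> = sets config_borel"
    and W: "finite W" and r: "r \<in> borel_measurable config_borel" "\<And>\<eta>. 0 \<le> r \<eta>" "\<And>\<eta>. r \<eta> \<le> K"
  shows "integrable \<nu> (\<lambda>\<eta>. indicator (cyl W w) \<eta> * r \<eta>)"
proof -
  interpret prob_space \<nu> by fact
  have "r \<in> borel_measurable \<nu>"
    using r(1) \<nu>(2) by (simp cong: measurable_cong_sets)
  moreover have "cyl W w \<in> sets \<nu>"
    using W \<nu>(2) by (simp add: cyl_in_sets)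
  ultimately show ?thesis
    using r(2,3) order_trans[OF r(2,3)]
    by (intro integrable_const_bound[of _ K] AE_I2) (auto simp: indicator_def)
qed

lemma mean_rate_bounds:
  fixes r :: "('d::finite, 'q::finite) config \<Rightarrow> real"
  assumes \<nu>: "prob_space \<nu>" "sets \<nu> = sets config_borel"
    and W: "finite W" and r: "r \<in> borel_measurable config_borel" "\<And>\<eta>. 0 \<le> r \<eta>" "\<And>\<eta>. r \<eta> \<le> K"
    and pos: "measure \<nu> (cyl W w) > 0"
    and bounds: "\<And>\<eta>. \<eta> \<in> cyl W w \<Longrightarrow> l \<le> r \<eta>" "\<And>\<eta>. \<eta> \<in> cyl W w \<Longrightarrow> r \<eta> \<le> u"
  shows "l \<le> mean_rate \<nu> r W w" "mean_rate \<nu> r W w \<le> u"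
proof -
  interpret prob_space \<nu> by fact
  have cyl: "cyl W w \<in> sets \<nu>"
    using W \<nu>(2) by (simp add: cyl_in_sets)
  have sp: "space \<nu> = UNIV"
    using \<nu>(2) by (metis sets_eq_imp_space_eq space_config_borel)
  note int = indicator_mult_integrable[OF \<nu> W r, of w]
  have const: "integrable \<nu> (\<lambda>\<eta>. indicator (cyl W w) \<eta> * a)"
    "(\<integral>\<eta>. indicator (cyl W w) \<eta> * a \<partial>\<nu>) = measure \<nu> (cyl W w) * a" for a :: real
    using cyl sp by (simp_all add: less_top[symmetric])
  have "measure \<nu> (cyl W w) * l \<le> (\<integral>\<eta>. indicator (cyl W w) \<eta> * r \<eta> \<partial>\<nu>)"
    unfolding const(2)[symmetric] using bounds(1)
    by (intro integral_mono const int) (auto simp: indicator_def)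
  then show "l \<le> mean_rate \<nu> r W w"
    using pos by (simp add: mean_rate_def field_simps)
  have "(\<integral>\<eta>. indicator (cyl W w) \<eta> * r \<eta> \<partial>\<nu>) \<le> measure \<nu> (cyl W w) * u"
    unfolding const(2)[symmetric] using bounds(2)
    by (intro integral_mono const int) (auto simp: indicator_def)
  then show "mean_rate \<nu> r W w \<le> u"
    using pos by (simp add: mean_rate_def field_simps)
qed

text \<open>From above, one tuple that nearly attains the infimum controls all larger windows by
  monotonicity. From below, every window is itself admissible in the infimum, so the sum for
  \<open>s\<close> is at least the infimum minus \<epsilon> B, and the scaled comparison transfers
  this to \<open>r\<close>.\<close>

lemma rate_sum_mean_rate_tendsto:
  fixes r :: "('d::finite, 'q::finite) config \<Rightarrow> real"
  assumes \<nu>: "prob_space \<nu>" "sets \<nu> = sets config_borel" and D: "finite D"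
    and r: "r \<in> borel_measurable config_borel" "\<And>\<eta>. 0 \<le> r \<eta>" "\<And>\<eta>. r \<eta> \<le> K"
    and squeeze: "\<And>\<epsilon>. 0 < \<epsilon> \<Longrightarrow> \<exists>V s. squeeze r \<epsilon> V s"
  shows "((\<lambda>W. rate_sum \<nu> D \<xi> W (mean_rate \<nu> r W)) \<longlongrightarrow>
    rate_inf \<nu> D \<xi> r (K * card (D \<rightarrow>\<^sub>E (UNIV :: 'q set)))) (finite_subsets_at_top UNIV)"
proof -
  let ?J = "\<lambda>W. rate_sum \<nu> D \<xi> W (mean_rate \<nu> r W)"
  let ?B = "K * card (D \<rightarrow>\<^sub>E (UNIV :: 'q set))"
  let ?F = "rate_inf \<nu> D \<xi> r ?B"
  \<comment> \<open>As soon as the window contains \<open>V\<close>, the local rate is constant on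
    each of its cylinders, so averaging \<open>r\<close> over a cylinder preserves the
    squeeze.\<close>
  have mean: "?J W \<le> rate_sum \<nu> D \<xi> W s + ereal (\<epsilon> * ?B)"
    "ereal (1 + \<epsilon>) * rate_sum \<nu> D \<xi> W s \<le> ?J W + ereal (\<epsilon> * ?B)"
    if "0 < \<epsilon>" "squeeze r \<epsilon> V s" "finite W" "V \<subseteq> W" "D \<subseteq> W" for \<epsilon> V s W
  proof -
    have "s w \<le> mean_rate \<nu> r W w \<and> mean_rate \<nu> r W w \<le> (1 + \<epsilon>) * s w"
      if p: "measure \<nu> (cyl W w) > 0" for w
    proof -
      have "s \<eta> = s w" if "\<eta> \<in> cyl W w" for \<eta>
        using that \<open>squeeze r \<epsilon> V s\<close> \<open>V \<subseteq> W\<close>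
        by (intro depends_onD[of s V]) (auto simp: squeeze_def cyl_def)
      moreover have "s \<eta> \<le> r \<eta>" "r \<eta> \<le> (1 + \<epsilon>) * s \<eta>" for \<eta>
        using \<open>squeeze r \<epsilon> V s\<close> by (auto simp: squeeze_def)
      ultimately have "s w \<le> r \<eta>" "r \<eta> \<le> (1 + \<epsilon>) * s w" if "\<eta> \<in> cyl W w" for \<eta>
        using that by metis+
      then show ?thesis
        using mean_rate_bounds[OF \<nu> \<open>finite W\<close> r p] by blast
    qed
    moreover have "0 \<le> s w" "s w \<le> K" for w
      using \<open>squeeze r \<epsilon> V s\<close> r(3)[of w] by (auto simp: squeeze_def intro: order_trans)
    ultimately show "?J W \<le> rate_sum \<nu> D \<xi> W s + ereal (\<epsilon> * ?B)"
      "ereal (1 + \<epsilon>) * rate_sum \<nu> D \<xi> W s \<le> ?J W + ereal (\<epsilon> * ?B)"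
      using that by (intro rate_sum_squeeze[OF \<nu>]; simp)+
  qed
  show ?thesis
    unfolding order_tendsto_iff
  proof (intro conjI allI impI)
    fix a assume "?F < a"
    then obtain \<epsilon> V s W0 where *: "0 < \<epsilon>" "squeeze r \<epsilon> V s" "finite W0" "V \<subseteq> W0" "D \<subseteq> W0"
      "rate_sum \<nu> D \<xi> W0 s + ereal (\<epsilon> * ?B) < a"
      by (auto simp: rate_inf_def INF_less_iff)
    have "?J W < a" if "finite W" "W0 \<subseteq> W" for W
    proof -
      have "depends_on s W0"
        using *(2,4) unfolding squeeze_def depends_on_def by blast
      then have "rate_sum \<nu> D \<xi> W s \<le> rate_sum \<nu> D \<xi> W0 s"
        using that * by (intro rate_sum_antimono[OF \<nu>]) (auto simp: squeeze_def)
      then have "?J W \<le> rate_sum \<nu> D \<xi> W0 s + ereal (\<epsilon> * ?B)"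
        using mean(1)[OF *(1,2) that(1)] that *
        by (meson add_right_mono order_trans)
      then show ?thesis using *(6) by simp
    qed
    then show "\<forall>\<^sub>F W in finite_subsets_at_top UNIV. ?J W < a"
      using *(3) by (auto simp: eventually_finite_subsets_at_top)
  next
    fix a assume a: "a < ?F"
    moreover obtain V s where "squeeze r 1 V s" using squeeze[of 1] by auto
    then have "?F < \<infinity>"
      by (rule rate_inf_less_PInf[OF D zero_less_one])
    \<comment> \<open>The assumption \<open>a < ?F\<close> excludes -\<infinity>, so the remaining
      estimates are real arithmetic.\<close>
    ultimately obtain f where f: "?F = ereal f" by (cases ?F) auto
    obtain b where b: "a < ereal b" "b < f"
      using ereal_dense2[OF a[unfolded f]] by auto
    \<comment> \<open>The expression is the lower bound for \<open>?J W\<close> obtained below; it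
      tends to \<open>f\<close>, so a small \<epsilon> keeps it above \<open>b\<close>.\<close>
    have "((\<lambda>\<epsilon>. (1 + \<epsilon>) * (f - \<epsilon> * ?B) - \<epsilon> * ?B) \<longlongrightarrow> (1 + 0) * (f - 0 * ?B) - 0 * ?B) (at_right 0)"
      by (intro tendsto_intros)
    then have "\<forall>\<^sub>F \<epsilon> in at_right 0. b < (1 + \<epsilon>) * (f - \<epsilon> * ?B) - \<epsilon> * ?B"
      using b(2) by (intro order_tendstoD(1)) auto
    moreover have "\<forall>\<^sub>F \<epsilon> in at_right (0 :: real). 0 < \<epsilon>"
      by (rule eventually_at_right_less)
    ultimately have "\<forall>\<^sub>F \<epsilon> in at_right 0. b < (1 + \<epsilon>) * (f - \<epsilon> * ?B) - \<epsilon> * ?B \<and> 0 < \<epsilon>"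
      by (rule eventually_conj)
    then obtain \<epsilon> where \<epsilon>: "b < (1 + \<epsilon>) * (f - \<epsilon> * ?B) - \<epsilon> * ?B" "0 < \<epsilon>"
      using eventually_happens'[OF trivial_limit_at_right_real] by blast
    obtain V s where s: "squeeze r \<epsilon> V s" using squeeze \<epsilon>(2) by blast
    have "a < ?J W" if "finite W" "V \<union> D \<subseteq> W" for W
    proof -
      have "ereal f \<le> rate_sum \<nu> D \<xi> W s + ereal (\<epsilon> * ?B)"
        unfolding f[symmetric] rate_inf_def using that \<epsilon> s
        by (intro INF_lower2[of "(\<epsilon>, V, s, W)"]) auto
      then have "ereal (f - \<epsilon> * ?B) \<le> rate_sum \<nu> D \<xi> W s"
        by (cases "rate_sum \<nu> D \<xi> W s") auto
      then have "ereal (1 + \<epsilon>) * ereal (f - \<epsilon> * ?B) \<le> ereal (1 + \<epsilon>) * rate_sum \<nu> D \<xi> W s"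
        using \<epsilon>(2) by (intro ereal_mult_left_mono) auto
      also have "\<dots> \<le> ?J W + ereal (\<epsilon> * ?B)"
        using that \<epsilon> s by (intro mean(2)) auto
      finally have "ereal ((1 + \<epsilon>) * (f - \<epsilon> * ?B) - \<epsilon> * ?B) \<le> ?J W"
        by (cases "?J W") auto
      then have "ereal b < ?J W"
        using \<epsilon>(1) by (meson ereal_less_eq(3) less_ereal.simps(1) less_le_trans)
      then show ?thesis using b(1) by simp
    qed
    moreover have "finite (V \<union> D)" using s D by (simp add: squeeze_def)
    ultimately show "\<forall>\<^sub>F W in finite_subsets_at_top UNIV. a < ?J W"
      by (auto simp: eventually_finite_subsets_at_top)
  qed
qed

section \<open>From the integral with logarithms to a sum over patterns\<close>

lemma ereal_integral_depends_on:
  fixes r :: "('d::finite, 'q::finite) config \<Rightarrow> real" and E :: "('d, 'q) config \<Rightarrow> ereal"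
  assumes \<nu>: "prob_space \<nu>" "sets \<nu> = sets config_borel"
    and W: "finite W" and r: "r \<in> borel_measurable config_borel" "\<And>\<eta>. 0 \<le> r \<eta>" "\<And>\<eta>. r \<eta> \<le> K"
    and E: "depends_on E W" "\<And>\<eta>. E \<eta> < \<infinity>"
  shows "ereal_integral \<nu> (\<lambda>\<eta>. ereal (r \<eta>) * E \<eta>) =
    (\<Sum>w \<in> W \<rightarrow>\<^sub>E UNIV. ereal (\<integral>\<eta>. indicator (cyl W w) \<eta> * r \<eta> \<partial>\<nu>) * E w)"
proof -
  let ?M = "\<lambda>w. \<integral>\<eta>. indicator (cyl W w) \<eta> * r \<eta> \<partial>\<nu>"
  have M: "0 \<le> ?M w" for w
    using r by (intro integral_nonneg_AE AE_I2) auto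
  have rm: "r \<in> borel_measurable \<nu>"
    using r(1) \<nu>(2) by (simp cong: measurable_cong_sets)
  have cyl: "cyl W w \<in> sets \<nu>" for w
    using W \<nu>(2) by (simp add: cyl_in_sets)
  \<comment> \<open>\<open>ereal_integral\<close> treats positive and negative parts separately;
    this formula is used for \<open>E\<close> and for \<open>- E\<close>. For each configuration
    exactly one pattern contributes.\<close>
  have part: "enn2ereal (\<integral>\<^sup>+\<eta>. e2ennreal (ereal (r \<eta>) * G \<eta>) \<partial>\<nu>) =
      (\<Sum>w \<in> W \<rightarrow>\<^sub>E UNIV. ereal (?M w) * max 0 (G w))"
    if G: "depends_on G W" for G :: "('d, 'q) config \<Rightarrow> ereal"
  proof -
    have mult: "e2ennreal (ereal (r \<eta>) * g) = ennreal (r \<eta>) * e2ennreal g" for \<eta> g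
    proof (cases "0 \<le> g")
      case True
      then have "ereal (r \<eta>) * g = enn2ereal (ennreal (r \<eta>) * e2ennreal g)"
        using r(2)[of \<eta>] by (simp add: times_ennreal.rep_eq enn2ereal_e2ennreal)
      then show ?thesis by (simp only: e2ennreal_enn2ereal)
    next
      case False
      then have "ereal (r \<eta>) * g \<le> 0"
        using r(2)[of \<eta>] by (simp add: ereal_mult_le_0_iff)
      then show ?thesis
        using False by (simp add: e2ennreal_neg)
    qed
    have "e2ennreal (ereal (r \<eta>) * G \<eta>) =
        (\<Sum>w \<in> W \<rightarrow>\<^sub>E UNIV. ennreal (indicator (cyl W w) \<eta> * r \<eta>) * e2ennreal (G w))" for \<eta>
    proof -
      have "(\<Sum>w \<in> W \<rightarrow>\<^sub>E UNIV. ennreal (indicator (cyl W w) \<eta> * r \<eta>) * e2ennreal (G w))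
        = (\<Sum>w \<in> W \<rightarrow>\<^sub>E UNIV. if w = restrict \<eta> W then ennreal (r \<eta>) * e2ennreal (G w) else 0)"
      proof (intro sum.cong refl)
        fix w :: "('d, 'q) config" assume w: "w \<in> W \<rightarrow>\<^sub>E UNIV"
        have "\<eta> \<in> cyl W w \<longleftrightarrow> w = restrict \<eta> W"
        proof
          assume "\<eta> \<in> cyl W w"
          then show "w = restrict \<eta> W"
            using w by (intro PiE_ext[of w W "\<lambda>_. UNIV"]) (auto simp: cyl_def)
        qed (simp add: cyl_def)
        then show "ennreal (indicator (cyl W w) \<eta> * r \<eta>) * e2ennreal (G w) =
            (if w = restrict \<eta> W then ennreal (r \<eta>) * e2ennreal (G w) else 0)"
          by (simp add: indicator_def)
      qed
      also have "\<dots> = ennreal (r \<eta>) * e2ennreal (G (restrict \<eta> W))"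
        by (simp add: sum.delta[OF finite_PiE_UNIV[OF W]])
      also have "G (restrict \<eta> W) = G \<eta>"
        by (intro depends_onD[OF G]) auto
      finally show ?thesis by (simp add: mult)
    qed
    then have "(\<integral>\<^sup>+\<eta>. e2ennreal (ereal (r \<eta>) * G \<eta>) \<partial>\<nu>) =
      (\<Sum>w \<in> W \<rightarrow>\<^sub>E UNIV. \<integral>\<^sup>+\<eta>. ennreal (indicator (cyl W w) \<eta> * r \<eta>) * e2ennreal (G w) \<partial>\<nu>)"
      using rm cyl by (simp add: nn_integral_sum)
    also have "\<dots> = (\<Sum>w \<in> W \<rightarrow>\<^sub>E UNIV. ennreal (?M w) * e2ennreal (G w))"
    proof (intro sum.cong refl)
      fix w
      have "(\<integral>\<^sup>+\<eta>. ennreal (indicator (cyl W w) \<eta> * r \<eta>) * e2ennreal (G w) \<partial>\<nu>)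
        = (\<integral>\<^sup>+\<eta>. ennreal (indicator (cyl W w) \<eta> * r \<eta>) \<partial>\<nu>) * e2ennreal (G w)"
        using rm cyl by (intro nn_integral_multc) auto
      also have "(\<integral>\<^sup>+\<eta>. ennreal (indicator (cyl W w) \<eta> * r \<eta>) \<partial>\<nu>) = ennreal (?M w)"
        using r(2) by (intro nn_integral_eq_integral indicator_mult_integrable[OF \<nu> W r] AE_I2) auto
      finally show "(\<integral>\<^sup>+\<eta>. ennreal (indicator (cyl W w) \<eta> * r \<eta>) * e2ennreal (G w) \<partial>\<nu>)
        = ennreal (?M w) * e2ennreal (G w)" .
    qed
    finally have "(\<integral>\<^sup>+\<eta>. e2ennreal (ereal (r \<eta>) * G \<eta>) \<partial>\<nu>)
      = (\<Sum>w \<in> W \<rightarrow>\<^sub>E UNIV. ennreal (?M w) * e2ennreal (G w))" .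
    moreover have "enn2ereal (ennreal (?M w) * e2ennreal (G w)) = ereal (?M w) * max 0 (G w)" for w
    proof (cases "0 \<le> G w")
      case True
      then show ?thesis
        using M[of w] by (simp add: times_ennreal.rep_eq enn2ereal_ennreal enn2ereal_e2ennreal max_absorb2)
    next
      case False
      then show ?thesis
        by (simp add: e2ennreal_neg max_absorb1 zero_ennreal.rep_eq)
    qed
    ultimately show ?thesis
      by (simp flip: sum_enn2ereal)
  qed
  have "depends_on (\<lambda>\<eta>. - E \<eta>) W"
    using E(1) by (simp add: depends_on_def)
  note neg = part[OF this]
  have "ereal_integral \<nu> (\<lambda>\<eta>. ereal (r \<eta>) * E \<eta>) =
    (\<Sum>w \<in> W \<rightarrow>\<^sub>E UNIV. ereal (?M w) * max 0 (E w)) - (\<Sum>w \<in> W \<rightarrow>\<^sub>E UNIV. ereal (?M w) * max 0 (- E w))"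
    unfolding ereal_integral_def part[OF E(1)] using neg by simp
  \<comment> \<open>Since \<open>E\<close> never takes the value \<infinity>, the positive parts are
    finite and the two sums can be subtracted termwise.\<close>
  also have "\<dots> = (\<Sum>w \<in> W \<rightarrow>\<^sub>E UNIV. ereal (?M w) * max 0 (E w) - ereal (?M w) * max 0 (- E w))"
    using M E(2) by (intro sum_ereal_diff ereal_mult_less_PInf) (auto simp: max_def)
  also have "\<dots> = (\<Sum>w \<in> W \<rightarrow>\<^sub>E UNIV. ereal (?M w) * E w)"
  proof (intro sum.cong refl)
    fix w
    show "ereal (?M w) * max 0 (E w) - ereal (?M w) * max 0 (- E w) = ereal (?M w) * E w"
      using E(2)[of w] M[of w]
      by (cases "E w"; cases "?M w = 0") (auto simp: max_def simp flip: zero_ereal_def)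
  qed
  finally show ?thesis .
qed

text \<open>One summand of \<open>entropy_loss_approx\<close> with an arbitrary window in place of
  \<open>Lam n\<close>, so that translated boxes can be inserted.\<close>

definition flip_term ::
  "('d::finite, 'q::finite) config measure \<Rightarrow> 'd site set \<Rightarrow> ('d, 'q) config \<Rightarrow> 'd site set
     \<Rightarrow> (('d, 'q) config \<Rightarrow> real) \<Rightarrow> ereal" where
  "flip_term \<nu> D \<xi> W r = ereal_integral \<nu> (\<lambda>\<eta>. ereal (r \<eta>) *
     elog (cyl_cond_prob \<nu> (D \<inter> W) \<xi> (W - D) \<eta> / cyl_cond_prob \<nu> (D \<inter> W) \<eta> (W - D) \<eta>))"

lemma cyl_cond_prob_depends_on:
  "depends_on (\<lambda>\<eta>. elog (cyl_cond_prob \<nu> (D \<inter> W) \<xi> (W - D) \<eta> / cyl_cond_prob \<nu> (D \<inter> W) \<eta> (W - D) \<eta>)) W"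
  unfolding depends_on_def
proof (intro allI impI)
  fix \<eta> \<zeta> :: "('a, 'b) config" assume eq: "\<forall>x\<in>W. \<eta> x = \<zeta> x"
  have "(\<forall>x\<in>W - D. \<omega> x = \<eta> x) \<longleftrightarrow> (\<forall>x\<in>W - D. \<omega> x = \<zeta> x)"
    "(\<forall>x\<in>D \<inter> W. \<omega> x = \<eta> x) \<longleftrightarrow> (\<forall>x\<in>D \<inter> W. \<omega> x = \<zeta> x)" for \<omega> :: "('a, 'b) config"
    using eq by auto
  then show "elog (cyl_cond_prob \<nu> (D \<inter> W) \<xi> (W - D) \<eta> / cyl_cond_prob \<nu> (D \<inter> W) \<eta> (W - D) \<eta>)
    = elog (cyl_cond_prob \<nu> (D \<inter> W) \<xi> (W - D) \<zeta> / cyl_cond_prob \<nu> (D \<inter> W) \<zeta> (W - D) \<zeta>)"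
    by (simp only: cyl_cond_prob_def)
qed

text \<open>Both conditional probabilities have the probability of the pattern on
  \<open>W - D\<close> as denominator, which cancels in the quotient. The factor p of
  \<open>plog\<close> comes from writing the integral over a cylinder as mean rate times
  probability. On null cylinders both sides are 0, as 0 times -\<infinity> is 0.\<close>

lemma flip_term_eq_rate_sum:
  fixes r :: "('d::finite, 'q::finite) config \<Rightarrow> real"
  assumes \<nu>: "prob_space \<nu>" "sets \<nu> = sets config_borel"
    and W: "finite W" "D \<subseteq> W"
    and r: "r \<in> borel_measurable config_borel" "\<And>\<eta>. 0 \<le> r \<eta>" "\<And>\<eta>. r \<eta> \<le> K"
  shows "flip_term \<nu> D \<xi> W r = rate_sum \<nu> D \<xi> W (mean_rate \<nu> r W)"
proof -
  interpret prob_space \<nu> by fact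
  let ?M = "\<lambda>w. \<integral>\<eta>. indicator (cyl W w) \<eta> * r \<eta> \<partial>\<nu>"
  let ?E = "\<lambda>\<eta>. elog (cyl_cond_prob \<nu> (D \<inter> W) \<xi> (W - D) \<eta> / cyl_cond_prob \<nu> (D \<inter> W) \<eta> (W - D) \<eta>)"
  have sp: "space \<nu> = UNIV"
    using \<nu>(2) by (metis sets_eq_imp_space_eq space_config_borel)
  have sets: "cyl V w \<in> sets \<nu>" if "finite V" for V w
    using that \<nu>(2) by (simp add: cyl_in_sets)
  have "flip_term \<nu> D \<xi> W r = (\<Sum>w \<in> W \<rightarrow>\<^sub>E UNIV. ereal (?M w) * ?E w)"
    unfolding flip_term_def
    by (rule ereal_integral_depends_on[OF \<nu> W(1) r cyl_cond_prob_depends_on]) (simp add: elog_def)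
  also have "\<dots> = rate_sum \<nu> D \<xi> W (mean_rate \<nu> r W)"
    unfolding rate_sum_def
  proof (intro sum.cong refl)
    fix w
    let ?p = "measure \<nu> (cyl W w)" and ?q = "measure \<nu> (cyl W (override_on w \<xi> D))"
      and ?m = "measure \<nu> (cyl (W - D) w)"
    show "ereal (?M w) * ?E w = ereal (mean_rate \<nu> r W w) * plog ?p ?q"
    proof (cases "?p = 0")
      case True
      then have "AE \<eta> in \<nu>. \<eta> \<notin> cyl W w"
        using sets[OF W(1), of w] by (intro AE_not_in) (simp add: null_sets_def emeasure_eq_measure)
      then have "?M w = (\<integral>\<eta>. 0 \<partial>\<nu>)"
        using sets[OF W(1), of w] r(1) \<nu>(2)
        by (intro integral_cong_AE) (auto cong: measurable_cong_sets)
      then show ?thesis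
        using True by (simp add: plog_def mean_rate_def flip: zero_ereal_def)
    next
      case False
      then have p: "?p > 0" by (simp add: zero_less_measure_iff)
      have "?p \<le> ?m"
        using W by (intro finite_measure_mono sets) (auto simp: cyl_def)
      then have m: "?m > 0" using p by simp
      have "{\<omega> \<in> space \<nu>. (\<forall>x\<in>D \<inter> W. \<omega> x = \<xi> x) \<and> (\<forall>x\<in>W - D. \<omega> x = w x)} = cyl W (override_on w \<xi> D)"
        "{\<omega> \<in> space \<nu>. (\<forall>x\<in>D \<inter> W. \<omega> x = w x) \<and> (\<forall>x\<in>W - D. \<omega> x = w x)} = cyl W w"
        "{\<omega> \<in> space \<nu>. (\<forall>x\<in>W - D. \<omega> x = w x)} = cyl (W - D) w"
        using W by (auto simp: sp cyl_def override_on_def)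
      then have "?E w = elog (?q / ?p)"
        using m by (simp add: cyl_cond_prob_def cond_prob_def)
      moreover have "ereal (mean_rate \<nu> r W w) * ereal ?p = ereal (?M w)"
        using p by (simp add: mean_rate_def)
      ultimately show ?thesis
        by (simp only: plog_def mult.assoc[symmetric])
    qed
  qed
  finally show ?thesis .
qed

section \<open>Rates and translations\<close>

lemma uniformly_continuous_ratesD:
  fixes c :: "('d::finite, 'q::finite) rates"
  assumes "uniformly_continuous_rates c" "0 < \<epsilon>"
  obtains V where "finite V"
    "\<And>D \<eta> \<sigma> \<xi>. finite D \<Longrightarrow> 0 \<in> D \<Longrightarrow> \<xi> \<in> D \<rightarrow>\<^sub>E UNIV \<Longrightarrow>
      \<bar>c D (override_on \<sigma> \<eta> V) \<xi> - c D \<eta> \<xi>\<bar> < \<epsilon>"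
proof -
  let ?S = "\<lambda>V. SUP D \<in> {D. finite D \<and> 0 \<in> D}. SUP \<eta>. SUP \<sigma>. SUP \<xi> \<in> D \<rightarrow>\<^sub>E UNIV.
         ennreal \<bar>c D (override_on \<sigma> \<eta> V) \<xi> - c D \<eta> \<xi>\<bar>"
  have "\<forall>\<^sub>F V in finite_subsets_at_top UNIV. ?S V < ennreal \<epsilon>"
    using assms unfolding uniformly_continuous_rates_def by (intro order_tendstoD(2)) auto
  then obtain V where V: "finite V" "?S V < ennreal \<epsilon>"
    by (auto simp: eventually_finite_subsets_at_top)
  show thesis
  proof
    fix D \<eta> \<sigma> and \<xi> :: "('d, 'q) config"
    assume "finite D" "0 \<in> D" "\<xi> \<in> D \<rightarrow>\<^sub>E UNIV"
    then have "ennreal \<bar>c D (override_on \<sigma> \<eta> V) \<xi> - c D \<eta> \<xi>\<bar> \<le> ?S V"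
      by (intro SUP_upper2[of D] SUP_upper2[of \<eta>] SUP_upper2[of \<sigma>] SUP_upper2[of \<xi>]) auto
    then have "ennreal \<bar>c D (override_on \<sigma> \<eta> V) \<xi> - c D \<eta> \<xi>\<bar> < ennreal \<epsilon>"
      using V(2) by (rule le_less_trans)
    then show "\<bar>c D (override_on \<sigma> \<eta> V) \<xi> - c D \<eta> \<xi>\<bar> < \<epsilon>"
      by (simp add: ennreal_less_iff)
  qed (rule V(1))
qed

lemma positive_minimal_rateD:
  fixes c :: "('d::finite, 'q::finite) rates"
  assumes "positive_minimal_rate c" "finite D" "D \<noteq> {}" "max_rate c D > 0"
  obtains \<delta> where "0 < \<delta>" "\<And>\<eta> \<xi>. \<xi> \<in> D \<rightarrow>\<^sub>E UNIV \<Longrightarrow> 0 < c D \<eta> \<xi> \<Longrightarrow> \<delta> \<le> c D \<eta> \<xi>"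
proof
  let ?P = "{(\<eta>, \<xi>). \<xi> \<in> D \<rightarrow>\<^sub>E UNIV \<and> c D \<eta> \<xi> > 0}"
  show "0 < (INF (\<eta>, \<xi>) \<in> ?P. c D \<eta> \<xi>)"
    using assms by (auto simp: positive_minimal_rate_def)
  fix \<eta> and \<xi> :: "('d, 'q) config" assume "\<xi> \<in> D \<rightarrow>\<^sub>E UNIV" "0 < c D \<eta> \<xi>"
  then show "(INF (\<eta>, \<xi>) \<in> ?P. c D \<eta> \<xi>) \<le> c D \<eta> \<xi>"
    by (intro cINF_lower2[where x = "(\<eta>, \<xi>)"] bdd_belowI2[of _ 0]) auto
qed

text \<open>
  The positive minimal rate makes \<open>{\<eta>. c D \<eta> \<xi> > 0}\<close> a local event, which upgrades the uniform
  additive approximation by local rates to a multiplicative one.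
\<close>

lemma ex_squeeze_rates:
  fixes c :: "('d::finite, 'q::finite) rates"
  assumes c: "ips_rates c" "uniformly_continuous_rates c" "positive_minimal_rate c"
    and D: "finite D" "0 \<in> D" "max_rate c D > 0" and \<xi>: "\<xi> \<in> D \<rightarrow>\<^sub>E UNIV" and \<epsilon>: "0 < \<epsilon>"
  shows "\<exists>V s. squeeze (\<lambda>\<eta>. c D \<eta> \<xi>) \<epsilon> V s"
proof -
  have ne: "D \<noteq> {}" using D by auto
  obtain \<delta> where \<delta>: "0 < \<delta>" "\<And>\<eta>. 0 < c D \<eta> \<xi> \<Longrightarrow> \<delta> \<le> c D \<eta> \<xi>"
    using positive_minimal_rateD[OF c(3) D(1) ne D(3)] \<xi> by metis
  \<comment> \<open>Chosen so that (1 + \<epsilon>)(1 - \<theta>) = 1 + \<theta>: a relative error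
    \<theta> in both directions becomes a one-sided factor 1 + \<epsilon> once the local rate is
    scaled down by 1 - \<theta>.\<close>
  define \<theta> where "\<theta> = \<epsilon> / (2 + \<epsilon>)"
  have \<theta>: "0 < \<theta>" "\<theta> < 1" "(1 + \<epsilon>) * (1 - \<theta>) = 1 + \<theta>"
    using \<epsilon> by (auto simp: \<theta>_def field_simps)
  obtain V where V: "finite V"
    "\<And>\<eta> \<sigma>. \<bar>c D (override_on \<sigma> \<eta> V) \<xi> - c D \<eta> \<xi>\<bar> < \<theta> * \<delta>"
    using uniformly_continuous_ratesD[OF c(2), of "\<theta> * \<delta>"] \<theta> \<delta>(1) D \<xi> by (metis mult_pos_pos)
  have nonneg: "0 \<le> c D \<eta> \<xi>" for \<eta>
    using c(1) D(1) ne \<xi> by (simp add: ips_rates_def)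
  \<comment> \<open>Freezing the configuration off \<open>V\<close> to an arbitrary fixed one makes
    the rate local.\<close>
  let ?a = "\<lambda>\<eta>. c D (override_on undefined \<eta> V) \<xi>"
  have "depends_on (\<lambda>\<eta>. (1 - \<theta>) * ?a \<eta>) V"
    unfolding depends_on_def
  proof (intro allI impI)
    fix \<eta> \<zeta> :: "('d, 'q) config" assume "\<forall>x\<in>V. \<eta> x = \<zeta> x"
    then have "override_on undefined \<eta> V = override_on undefined \<zeta> V"
      by (auto simp: override_on_def)
    then show "(1 - \<theta>) * ?a \<eta> = (1 - \<theta>) * ?a \<zeta>" by simp
  qed
  moreover have "(1 - \<theta>) * ?a \<eta> \<le> c D \<eta> \<xi> \<and> c D \<eta> \<xi> \<le> (1 + \<epsilon>) * ((1 - \<theta>) * ?a \<eta>)" for \<eta>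
  proof (cases "?a \<eta> = 0")
    case True
    \<comment> \<open>The error is smaller than the gap \<delta> between 0 and the positive rates,
      so a vanishing frozen rate forces the true rate to vanish.\<close>
    have "\<theta> * \<delta> < \<delta>" using \<theta> \<delta>(1) by simp
    then have "c D \<eta> \<xi> = 0"
      using V(2)[of undefined \<eta>] True \<delta>(2)[of \<eta>] nonneg[of \<eta>] by linarith
    then show ?thesis using True by simp
  next
    case False
    then have "\<delta> \<le> ?a \<eta>"
      using \<delta>(2)[of "override_on undefined \<eta> V"] nonneg[of "override_on undefined \<eta> V"] by simp
    then have "\<theta> * \<delta> \<le> \<theta> * ?a \<eta>" using \<theta> by simp
    then have "(1 - \<theta>) * ?a \<eta> \<le> c D \<eta> \<xi>" "c D \<eta> \<xi> \<le> (1 + \<theta>) * ?a \<eta>"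
      using V(2)[of undefined \<eta>] by (auto simp: algebra_simps)
    then show ?thesis by (simp add: mult.assoc[symmetric] \<theta>(3))
  qed
  moreover have "0 \<le> (1 - \<theta>) * ?a \<eta>" for \<eta> using nonneg \<theta> by simp
  ultimately have "squeeze (\<lambda>\<eta>. c D \<eta> \<xi>) \<epsilon> V (\<lambda>\<eta>. (1 - \<theta>) * ?a \<eta>)"
    using V(1) by (simp add: squeeze_def)
  then show ?thesis by blast
qed

text \<open>A local function takes only finitely many values; boundedness of the rate thus comes
  from the squeeze and not from compactness of the configuration space.\<close>

lemma squeeze_bdd_above:
  fixes r :: "('d::finite, 'q::finite) config \<Rightarrow> real"
  assumes "squeeze r \<epsilon> V s" "0 < \<epsilon>"
  shows "bdd_above (range r)"
proof -
  have V: "finite V" and s: "depends_on s V" and r: "\<And>\<eta>. r \<eta> \<le> (1 + \<epsilon>) * s \<eta>"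
    using assms(1) by (auto simp: squeeze_def)
  have "range s \<subseteq> s ` (V \<rightarrow>\<^sub>E UNIV)"
  proof
    fix y assume "y \<in> range s"
    then obtain \<eta> where "y = s \<eta>" by auto
    moreover have "s \<eta> = s (restrict \<eta> V)" by (intro depends_onD[OF s]) simp
    ultimately show "y \<in> s ` (V \<rightarrow>\<^sub>E UNIV)" by simp
  qed
  then have "finite (range s)"
    by (rule finite_subset[OF _ finite_imageI[OF finite_PiE_UNIV[OF V]]])
  then have "s \<eta> \<le> Max (range s)" for \<eta> by simp
  then have "(1 + \<epsilon>) * s \<eta> \<le> (1 + \<epsilon>) * Max (range s)" for \<eta>
    using assms(2) by (simp add: mult_left_mono)
  then show ?thesis
    using r by (intro bdd_aboveI2[of _ _ "(1 + \<epsilon>) * Max (range s)"]) (meson order_trans)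
qed

section \<open>Translation of patterns, rates, probabilities and integrals\<close>

lemma shift_shift [simp]: "shift a (shift b \<eta>) = shift (a + b) \<eta>"
  by (simp add: shift_def algebra_simps)

lemma shift_0 [simp]: "shift 0 \<eta> = \<eta>"
  by (simp add: shift_def)

lemma shift_PiE: "\<xi> \<in> D \<rightarrow>\<^sub>E UNIV \<Longrightarrow> shift a \<xi> \<in> (\<lambda>x. a + x) ` D \<rightarrow>\<^sub>E UNIV"
proof (rule PiE_I)
  fix x assume \<xi>: "\<xi> \<in> D \<rightarrow>\<^sub>E UNIV" and x: "x \<notin> (\<lambda>x. a + x) ` D"
  have "x - a \<notin> D" using x image_eqI[of x "\<lambda>x. a + x" "x - a" D] by auto
  then show "shift a \<xi> x = undefined" using PiE_arb[OF \<xi>] by (simp add: shift_def)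
qed simp

lemma shift_minus_PiE: "\<xi> \<in> (\<lambda>x. a + x) ` D \<rightarrow>\<^sub>E UNIV \<Longrightarrow> shift (- a) \<xi> \<in> D \<rightarrow>\<^sub>E UNIV"
proof (rule PiE_I)
  fix x assume \<xi>: "\<xi> \<in> (\<lambda>x. a + x) ` D \<rightarrow>\<^sub>E UNIV" and x: "x \<notin> D"
  have "x + a \<notin> (\<lambda>x. a + x) ` D" using x by (auto simp: add.commute)
  then show "shift (- a) \<xi> x = undefined" using PiE_arb[OF \<xi>] by (simp add: shift_def)
qed simp

lemma sum_shift:
  fixes h :: "('d::finite, 'q::finite) config \<Rightarrow> 'b::comm_monoid_add"
  shows "(\<Sum>\<xi> \<in> (\<lambda>x. a + x) ` D \<rightarrow>\<^sub>E UNIV. h \<xi>) = (\<Sum>\<xi> \<in> D \<rightarrow>\<^sub>E UNIV. h (shift a \<xi>))"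
  by (rule sum.reindex_bij_witness[where i = "shift a" and j = "shift (- a)"])
    (simp_all add: shift_PiE shift_minus_PiE)

lemma max_rate_translate:
  fixes c :: "('d::finite, 'q::finite) rates"
  assumes c: "translation_invariant_rates c" and D: "finite D" "D \<noteq> {}"
  shows "max_rate c ((\<lambda>x. a + x) ` D) = max_rate c D"
proof -
  have "exit_rate c ((\<lambda>x. a + x) ` D) (shift a \<eta>) = exit_rate c D \<eta>" for \<eta>
  proof -
    have "shift a \<xi> = restrict (shift a \<eta>) ((\<lambda>x. a + x) ` D) \<longleftrightarrow> \<xi> = restrict \<eta> D"
      if "\<xi> \<in> D \<rightarrow>\<^sub>E UNIV" for \<xi>
    proof -
      have "restrict (shift a \<eta>) ((\<lambda>x. a + x) ` D) = shift a (restrict \<eta> D)"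
        by (auto simp: shift_def restrict_def fun_eq_iff image_iff algebra_simps)
      moreover have "shift a \<xi> = shift a \<zeta> \<longleftrightarrow> \<xi> = \<zeta>" for \<zeta>
        by (metis shift_shift shift_0 left_minus)
      ultimately show ?thesis by simp
    qed
    \<comment> \<open>Turning the excluded trivial transition into a zero summand lets the sum run
      over all patterns, where \<open>sum_shift\<close> applies.\<close>
    then have "exit_rate c D \<eta> = (\<Sum>\<xi> \<in> D \<rightarrow>\<^sub>E UNIV.
        if shift a \<xi> = restrict (shift a \<eta>) ((\<lambda>x. a + x) ` D) then 0
        else c ((\<lambda>x. a + x) ` D) (shift a \<eta>) (shift a \<xi>))"
      using c D finite_PiE_UNIV[OF D(1), where 'q = 'q]
      by (auto simp: exit_rate_def translation_invariant_rates_def sum.If_cases intro!: sum.mono_neutral_cong_left)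
    also have "\<dots> = (\<Sum>\<xi> \<in> (\<lambda>x. a + x) ` D \<rightarrow>\<^sub>E UNIV.
        if \<xi> = restrict (shift a \<eta>) ((\<lambda>x. a + x) ` D) then 0
        else c ((\<lambda>x. a + x) ` D) (shift a \<eta>) \<xi>)"
      by (rule sum_shift[symmetric])
    also have "\<dots> = exit_rate c ((\<lambda>x. a + x) ` D) (shift a \<eta>)"
      using D(1) finite_PiE_UNIV[of "(\<lambda>x. a + x) ` D", where 'q = 'q]
      by (auto simp: exit_rate_def intro!: sum.mono_neutral_cong_right split: if_splits)
    finally show ?thesis ..
  qed
  moreover have "range (shift a :: ('d, 'q) config \<Rightarrow> _) = UNIV"
    by (metis shift_shift shift_0 right_minus surjI)
  then have "max_rate c ((\<lambda>x. a + x) ` D) = (SUP \<eta>. ennreal (exit_rate c ((\<lambda>x. a + x) ` D) (shift a \<eta>)))"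
    unfolding max_rate_def by (metis image_image)
  ultimately show ?thesis
    by (simp add: max_rate_def)
qed

lemma active_sets_translate:
  fixes c :: "('d::finite, 'q::finite) rates"
  assumes c: "translation_invariant_rates c"
  shows "{\<Delta>. finite \<Delta> \<and> i \<in> \<Delta> \<and> max_rate c \<Delta> > 0}
    = (\<lambda>D. (\<lambda>x. i + x) ` D) ` {D. finite D \<and> 0 \<in> D \<and> max_rate c D > 0}" (is "?L = ?R")
proof (intro equalityI subsetI)
  fix \<Delta> assume \<Delta>: "\<Delta> \<in> ?L"
  then have "\<Delta> \<noteq> {}" by auto
  then have "(\<lambda>x. - i + x) ` \<Delta> \<in> {D. finite D \<and> 0 \<in> D \<and> max_rate c D > 0}"
    using \<Delta> max_rate_translate[OF c, of \<Delta> "- i"] by auto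
  moreover have "\<Delta> = (\<lambda>x. i + x) ` (\<lambda>x. - i + x) ` \<Delta>"
    by (simp add: image_image)
  ultimately show "\<Delta> \<in> ?R" by blast
next
  fix \<Delta> assume "\<Delta> \<in> ?R"
  then show "\<Delta> \<in> ?L"
    using max_rate_translate[OF c] by fastforce
qed

lemma inv_measuresD:
  assumes "\<nu> \<in> inv_measures"
  shows "prob_space \<nu>" "sets \<nu> = sets config_borel" "distr \<nu> config_borel (shift a) = \<nu>"
  using assms by (auto simp: inv_measures_def)

lemma measure_shift_vimage:
  assumes \<nu>: "\<nu> \<in> inv_measures" and A: "A \<in> sets config_borel"
  shows "measure \<nu> (shift a -` A) = measure \<nu> A"
proof -
  have sp: "space \<nu> = UNIV"
    using inv_measuresD(2)[OF \<nu>] by (metis sets_eq_imp_space_eq space_config_borel)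
  have "measure \<nu> A = measure (distr \<nu> config_borel (shift a)) A"
    by (simp add: inv_measuresD(3)[OF \<nu>])
  also have "\<dots> = measure \<nu> (shift a -` A \<inter> space \<nu>)"
    using shift_measurable inv_measuresD(2)[OF \<nu>] A
    by (intro measure_distr) (simp_all cong: measurable_cong_sets)
  finally show ?thesis by (simp add: sp)
qed

lemma cyl_cond_prob_translate:
  fixes \<nu> :: "('d::finite, 'q::finite) config measure"
  assumes \<nu>: "\<nu> \<in> inv_measures" and fin: "finite \<Delta>" "finite \<Lambda>"
  shows "cyl_cond_prob \<nu> ((\<lambda>x. a + x) ` \<Delta>) (shift a \<xi>) ((\<lambda>x. a + x) ` \<Lambda>) (shift a \<eta>)
    = cyl_cond_prob \<nu> \<Delta> \<xi> \<Lambda> \<eta>"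
proof -
  have sp: "space \<nu> = UNIV"
    using inv_measuresD(2)[OF \<nu>] by (metis sets_eq_imp_space_eq space_config_borel)
  let ?A = "{\<omega>. (\<forall>x\<in>(\<lambda>x. a + x) ` \<Delta>. \<omega> x = shift a \<xi> x) \<and> (\<forall>x\<in>(\<lambda>x. a + x) ` \<Lambda>. \<omega> x = shift a \<eta> x)}"
    and ?B = "{\<omega>. \<forall>x\<in>(\<lambda>x. a + x) ` \<Lambda>. \<omega> x = shift a \<eta> x}"
  have "?A = cyl ((\<lambda>x. a + x) ` \<Delta>) (shift a \<xi>) \<inter> cyl ((\<lambda>x. a + x) ` \<Lambda>) (shift a \<eta>)"
    "?B = cyl ((\<lambda>x. a + x) ` \<Lambda>) (shift a \<eta>)"
    by (auto simp: cyl_def)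
  then have "?A \<in> sets config_borel" "?B \<in> sets config_borel"
    using fin by (auto intro!: sets.Int cyl_in_sets)
  then have "measure \<nu> ?A = measure \<nu> (shift a -` ?A)" "measure \<nu> ?B = measure \<nu> (shift a -` ?B)"
    by (simp_all only: measure_shift_vimage[OF \<nu>])
  moreover have "shift a -` ?A = {\<omega>. (\<forall>x\<in>\<Delta>. \<omega> x = \<xi> x) \<and> (\<forall>x\<in>\<Lambda>. \<omega> x = \<eta> x)}"
    "shift a -` ?B = {\<omega>. \<forall>x\<in>\<Lambda>. \<omega> x = \<eta> x}"
    by (auto simp: shift_def)
  ultimately show ?thesis
    by (simp only: cyl_cond_prob_def cond_prob_def sp UNIV_I simp_thms)
qed

lemma ereal_integral_shift:
  assumes \<nu>: "\<nu> \<in> inv_measures" and f: "f \<in> borel_measurable config_borel"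
  shows "ereal_integral \<nu> f = ereal_integral \<nu> (\<lambda>\<eta>. f (shift a \<eta>))"
proof -
  have "(\<integral>\<^sup>+\<eta>. g \<eta> \<partial>\<nu>) = (\<integral>\<^sup>+\<eta>. g (shift a \<eta>) \<partial>\<nu>)" if "g \<in> borel_measurable config_borel"
    for g :: "_ \<Rightarrow> ennreal"
  proof -
    have "(\<integral>\<^sup>+\<eta>. g \<eta> \<partial>\<nu>) = (\<integral>\<^sup>+\<eta>. g \<eta> \<partial>distr \<nu> config_borel (shift a))"
      by (simp add: inv_measuresD(3)[OF \<nu>])
    also have "\<dots> = (\<integral>\<^sup>+\<eta>. g (shift a \<eta>) \<partial>\<nu>)"
      using shift_measurable inv_measuresD(2)[OF \<nu>] that
      by (intro nn_integral_distr) (simp_all cong: measurable_cong_sets)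
    finally show ?thesis .
  qed
  moreover have "(\<lambda>\<eta>. e2ennreal (f \<eta>)) \<in> borel_measurable config_borel"
    "(\<lambda>\<eta>. e2ennreal (- f \<eta>)) \<in> borel_measurable config_borel"
    using f by measurable
  ultimately show ?thesis
    by (simp add: ereal_integral_def)
qed

lemma flip_term_translate:
  fixes c :: "('d::finite, 'q::finite) rates"
  assumes \<nu>: "\<nu> \<in> inv_measures" and c: "ips_rates c" "translation_invariant_rates c"
    and D: "finite D" "D \<noteq> {}" and \<xi>: "\<xi> \<in> D \<rightarrow>\<^sub>E UNIV" and W: "finite W"
  shows "flip_term \<nu> ((\<lambda>x. a + x) ` D) (shift a \<xi>) ((\<lambda>x. a + x) ` W)
      (\<lambda>\<eta>. c ((\<lambda>x. a + x) ` D) \<eta> (shift a \<xi>)) = flip_term \<nu> D \<xi> W (\<lambda>\<eta>. c D \<eta> \<xi>)"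
proof -
  let ?t = "\<lambda>D. (\<lambda>x. a + x) ` D"
  let ?E = "\<lambda>\<eta>. elog (cyl_cond_prob \<nu> (?t D \<inter> ?t W) (shift a \<xi>) (?t W - ?t D) \<eta>
    / cyl_cond_prob \<nu> (?t D \<inter> ?t W) \<eta> (?t W - ?t D) \<eta>)"
  have "(\<lambda>\<eta>. c (?t D) \<eta> (shift a \<xi>)) \<in> borel_measurable config_borel"
    using c(1) D shift_PiE[OF \<xi>, of a]
    by (intro continuous_map_config_measurable) (simp add: ips_rates_def)
  moreover have "?E \<in> borel_measurable config_borel"
    using W by (intro depends_on_measurable[OF _ cyl_cond_prob_depends_on]) simp
  ultimately have "(\<lambda>\<eta>. ereal (c (?t D) \<eta> (shift a \<xi>)) * ?E \<eta>) \<in> borel_measurable config_borel"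
    by (intro borel_measurable_ereal_times borel_measurable_ereal)
  note ereal_integral_shift[OF \<nu> this, of a]
  moreover have "c (?t D) (shift a \<eta>) (shift a \<xi>) = c D \<eta> \<xi>" for \<eta>
    using c(2) D \<xi> by (simp add: translation_invariant_rates_def)
  moreover have "?t D \<inter> ?t W = ?t (D \<inter> W)" "?t W - ?t D = ?t (W - D)"
    by (auto simp: image_iff)
  then have "?E (shift a \<eta>) = elog (cyl_cond_prob \<nu> (D \<inter> W) \<xi> (W - D) \<eta> / cyl_cond_prob \<nu> (D \<inter> W) \<eta> (W - D) \<eta>)" for \<eta>
    using D W by (simp add: cyl_cond_prob_translate[OF \<nu>])
  ultimately show ?thesis
    by (simp add: flip_term_def)
qed

section \<open>Averaging over the boxes\<close>

lemma card_box:
  "card (box r :: 'd::finite site set) = nat (2 * r + 1) ^ CARD('d)"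
  "finite (box r :: 'd::finite site set)"
proof -
  have box: "(box r :: 'd site set) = vec_lambda ` (UNIV \<rightarrow>\<^sub>E {- r..r})"
  proof (intro equalityI subsetI)
    fix x :: "'d site" assume "x \<in> box r"
    then show "x \<in> vec_lambda ` (UNIV \<rightarrow>\<^sub>E {- r..r})"
      by (intro image_eqI[of _ _ "vec_nth x"]) (auto simp: box_def)
  qed (auto simp: box_def PiE_iff)
  have "inj_on vec_lambda (UNIV \<rightarrow>\<^sub>E {- r..r} :: ('d \<Rightarrow> int) set)"
    by (intro inj_onI) (simp add: vec_lambda_inject)
  then show "card (box r :: 'd site set) = nat (2 * r + 1) ^ CARD('d)"
    unfolding box by (simp add: card_image card_PiE)
  show "finite (box r :: 'd site set)"
    unfolding box by (intro finite_imageI finite_PiE) auto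
qed

lemma finite_subset_box:
  assumes "finite (W :: 'd::finite site set)"
  obtains m :: nat where "W \<subseteq> box (int m)"
proof
  let ?K = "insert 0 ((\<lambda>(x, k). nat \<bar>x $ k\<bar>) ` (W \<times> UNIV))"
  have fin: "finite ?K" using assms by simp
  show "W \<subseteq> box (int (Max ?K))"
  proof
    fix x assume "x \<in> W"
    then have "nat \<bar>x $ k\<bar> \<le> Max ?K" for k
      by (intro Max_ge[OF fin]) force
    then have "\<bar>x $ k\<bar> \<le> int (Max ?K)" for k
      by (simp add: nat_le_iff)
    then show "x \<in> box (int (Max ?K))"
      by (auto simp: box_def abs_le_iff minus_le_iff)
  qed
qed

text \<open>The radii of \<open>Lam n\<close> and \<open>Lam_tilde n\<close> differ by
  \<open>n - 1\<close>, so a box of radius \<open>m\<close> around any site of the smaller one fits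
  into the larger one once \<open>m + 1 \<le> n\<close>.\<close>

lemma Lam_tilde_translate_superset:
  assumes "finite (W :: 'd::finite site set)"
  shows "\<forall>\<^sub>F n in sequentially. \<forall>i\<in>Lam_tilde n. W \<subseteq> (\<lambda>x. - i + x) ` Lam n"
proof -
  obtain m :: nat where m: "W \<subseteq> box (int m)" using finite_subset_box[OF assms] .
  have "W \<subseteq> (\<lambda>x. - i + x) ` Lam n" if n: "Suc m \<le> n" and i: "i \<in> Lam_tilde n" for n i
  proof
    fix x assume "x \<in> W"
    then have x: "- int m \<le> x $ k" "x $ k \<le> int m" for k
      using m by (auto simp: box_def)
    have "- (2 ^ n - int n) \<le> i $ k" "i $ k \<le> 2 ^ n - int n" for k
      using i by (auto simp: Lam_tilde_def box_def)
    then have "- (2 ^ n - 1) \<le> (i + x) $ k \<and> (i + x) $ k \<le> 2 ^ n - 1" for k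
      using x[of k] n by (smt (verit) vector_add_component of_nat_Suc of_nat_mono)
    then have "i + x \<in> Lam n"
      unfolding Lam_def box_def by blast
    then show "x \<in> (\<lambda>x. - i + x) ` Lam n"
      by (intro image_eqI[of _ _ "i + x"]) auto
  qed
  then show ?thesis
    unfolding eventually_sequentially by blast
qed

text \<open>The margin of order \<open>n\<close> is negligible against the side length of order
  \<open>2 ^ n\<close>.\<close>

lemma card_Lam_tilde_ratio:
  "(\<lambda>n. real (card (Lam_tilde n :: 'd::finite site set)) / real (card (Lam n :: 'd site set)))
    \<longlonglongrightarrow> 1"
proof -
  let ?f = "\<lambda>n. (2 * (2 ^ n - real n) + 1) / (2 * (2 ^ n - 1) + 1)"
  have "real (card (Lam_tilde n :: 'd site set)) / real (card (Lam n :: 'd site set)) = ?f n ^ CARD('d)" for n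
  proof -
    \<comment> \<open>This keeps the radius nonnegative, so that \<open>nat\<close> does not
      truncate.\<close>
    have "int n \<le> 2 ^ n" using less_exp[of n] by (metis less_imp_le of_nat_le_iff of_nat_numeral of_nat_power)
    then have "real (nat (2 * (2 ^ n - int n) + 1)) = 2 * (2 ^ n - real n) + 1"
      by (simp add: of_nat_nat)
    moreover have "real (nat (2 * (2 ^ n - 1) + 1)) = 2 * (2 ^ n - 1) + 1"
      by (simp add: of_nat_nat)
    ultimately show ?thesis
      by (simp only: Lam_tilde_def Lam_def card_box of_nat_power power_divide)
  qed
  moreover have "?f \<longlonglongrightarrow> 1"
    by real_asymp
  then have "(\<lambda>n. ?f n ^ CARD('d)) \<longlonglongrightarrow> 1"
    using tendsto_power[of ?f 1 sequentially "CARD('d)"] by simp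
  ultimately show ?thesis by simp
qed

text \<open>The translated windows pass any given finite set simultaneously for all sites of
  \<open>Lam_tilde n\<close>, so the summands are uniformly close to the limit. One-sided estimates
  with real levels also cover the limit -\<infinity>.\<close>

lemma box_average_tendsto:
  fixes G :: "'d::finite site set \<Rightarrow> ereal"
  assumes G: "(G \<longlongrightarrow> F) (finite_subsets_at_top UNIV)"
  shows "(\<lambda>n. ereal (1 / real (card (Lam n :: 'd site set))) *
    (\<Sum>i\<in>Lam_tilde n. G ((\<lambda>x. - i + x) ` Lam n))) \<longlonglongrightarrow> F"
proof -
  let ?L = "\<lambda>n. real (card (Lam n :: 'd site set))"
    and ?S = "\<lambda>n. \<Sum>i\<in>Lam_tilde n. G ((\<lambda>x. - i + x) ` Lam n)"
  have ev: "\<forall>\<^sub>F n in sequentially. \<forall>i\<in>Lam_tilde n. P (G ((\<lambda>x. - i + x) ` Lam n))"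
    if "\<forall>\<^sub>F W in finite_subsets_at_top UNIV. P (G W)" for P
  proof -
    have "\<exists>W. finite W \<and> (\<forall>V. finite V \<and> W \<subseteq> V \<longrightarrow> P (G V))"
      using that by (simp add: eventually_finite_subsets_at_top)
    then obtain W where W: "finite W" "\<forall>V. finite V \<and> W \<subseteq> V \<longrightarrow> P (G V)"
      by (elim exE conjE)
    have fin: "finite ((\<lambda>x. - i + x) ` Lam n)" for i :: "'d site" and n
      by (intro finite_imageI) (simp add: Lam_def card_box)
    from Lam_tilde_translate_superset[OF W(1)] show ?thesis
      by eventually_elim (intro ballI W(2)[rule_format] conjI fin; drule bspec; assumption)
  qed
  have const: "ereal (1 / ?L n) * (\<Sum>i\<in>(Lam_tilde n :: 'd site set). ereal b)
      = ereal (real (card (Lam_tilde n :: 'd site set)) / ?L n * b)" for n b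
    by simp
  have lim: "(\<lambda>n. real (card (Lam_tilde n :: 'd site set)) / ?L n * b) \<longlonglongrightarrow> b" for b
    using tendsto_mult[OF card_Lam_tilde_ratio tendsto_const[of b]] by simp
  show ?thesis
    unfolding order_tendsto_iff
  proof (intro conjI allI impI)
    \<comment> \<open>The level \<open>b\<close> bounds the summands; \<open>b'\<close> leaves room
      for the ratio of the box sizes, which multiplies \<open>b\<close> and is only asymptotically
      1.\<close>
    fix a assume "F < a"
    then obtain b where b: "F < ereal b" "ereal b < a" using ereal_dense2 by blast
    obtain b' where b': "b < b'" "ereal b' < a" using ereal_dense2[OF b(2)] by auto
    have "\<forall>\<^sub>F n in sequentially. \<forall>i\<in>Lam_tilde n. G ((\<lambda>x. - i + x) ` Lam n) < ereal b"
      using ev[OF order_tendstoD(2)[OF G b(1)]] .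
    moreover have "\<forall>\<^sub>F n in sequentially. real (card (Lam_tilde n :: 'd site set)) / ?L n * b < b'"
      using order_tendstoD(2)[OF lim b'(1)] .
    ultimately show "\<forall>\<^sub>F n in sequentially. ereal (1 / ?L n) * ?S n < a"
    proof eventually_elim
      case (elim n)
      have "ereal (1 / ?L n) * ?S n \<le> ereal (1 / ?L n) * (\<Sum>i\<in>(Lam_tilde n :: 'd site set). ereal b)"
        using elim(1) by (intro ereal_mult_left_mono sum_mono) (auto intro: less_imp_le)
      also have "\<dots> < ereal b'"
        unfolding const using elim(2) by simp
      finally show ?case using b'(2) by (rule less_trans)
    qed
  next
    fix a assume "a < F"
    then obtain b where b: "a < ereal b" "ereal b < F" using ereal_dense2 by blast
    obtain b' where b': "a < ereal b'" "b' < b" using ereal_dense2[OF b(1)] by auto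
    have "\<forall>\<^sub>F n in sequentially. \<forall>i\<in>Lam_tilde n. ereal b < G ((\<lambda>x. - i + x) ` Lam n)"
      using ev[OF order_tendstoD(1)[OF G b(2)]] .
    moreover have "\<forall>\<^sub>F n in sequentially. b' < real (card (Lam_tilde n :: 'd site set)) / ?L n * b"
      using order_tendstoD(1)[OF lim b'(2)] .
    ultimately show "\<forall>\<^sub>F n in sequentially. a < ereal (1 / ?L n) * ?S n"
    proof eventually_elim
      case (elim n)
      have "ereal b' < ereal (1 / ?L n) * (\<Sum>i\<in>(Lam_tilde n :: 'd site set). ereal b)"
        unfolding const using elim(2) by simp
      also have "\<dots> \<le> ereal (1 / ?L n) * ?S n"
        using elim(1) by (intro ereal_mult_left_mono sum_mono) (auto intro: less_imp_le)
      finally show ?case using b'(1) by (rule less_trans[rotated])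
    qed
  qed
qed

section \<open>Summation over the transitions at a site\<close>

lemma tendsto_sum_ereal_less_PInf:
  fixes f :: "'i \<Rightarrow> 'a \<Rightarrow> ereal"
  assumes "\<And>i. i \<in> I \<Longrightarrow> (f i \<longlongrightarrow> l i) F" "\<And>i. i \<in> I \<Longrightarrow> l i < \<infinity>"
  shows "((\<lambda>x. \<Sum>i\<in>I. f i x) \<longlongrightarrow> (\<Sum>i\<in>I. l i)) F"
  using assms
proof (induction I rule: infinite_finite_induct)
  case (insert i I)
  \<comment> \<open>Addition is discontinuous only where \<infinity> meets -\<infinity>; limits
    below \<infinity> avoid such points.\<close>
  have "l i \<noteq> \<infinity>" "sum l I \<noteq> \<infinity>"
    using insert.prems sum_ereal_less_PInf[of I l] by auto
  moreover have "((\<lambda>x. \<Sum>i\<in>I. f i x) \<longlongrightarrow> sum l I) F"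
    using insert by blast
  ultimately show ?case
    using insert by (auto intro!: tendsto_add_ereal_general)
qed auto

text \<open>The contribution of the origin seen through the window \<open>W\<close>. The weight is
  that of the original sum and becomes \<open>1 / card D\<close> once the window contains
  \<open>D\<close>.\<close>

definition site_term ::
  "('d::finite, 'q::finite) rates \<Rightarrow> ('d, 'q) config measure \<Rightarrow> 'd site set \<Rightarrow> ereal" where
  "site_term c \<nu> W = (\<Sum>D \<in> {D. finite D \<and> 0 \<in> D \<and> max_rate c D > 0}.
     ereal (1 / real (card (D \<inter> W))) * (\<Sum>\<xi> \<in> D \<rightarrow>\<^sub>E UNIV. flip_term \<nu> D \<xi> W (\<lambda>\<eta>. c D \<eta> \<xi>)))"

lemma entropy_loss_approx_eq:
  fixes c :: "('d::finite, 'q::finite) rates"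
  assumes \<nu>: "\<nu> \<in> inv_measures" and c: "ips_rates c" "translation_invariant_rates c"
  shows "entropy_loss_approx c n \<nu> = (\<Sum>i\<in>Lam_tilde n. site_term c \<nu> ((\<lambda>x. - i + x) ` Lam n))"
  unfolding entropy_loss_approx_def
proof (intro sum.cong refl)
  fix i :: "'d site"
  let ?A = "{D. finite D \<and> 0 \<in> D \<and> max_rate c D > 0}"
  let ?t = "\<lambda>D. (\<lambda>x. i + x) ` D" and ?W = "(\<lambda>x. - i + x) ` (Lam n :: 'd site set)"
  have W: "Lam n = ?t ?W" by (simp add: image_image)
  have fin: "finite ?W" by (intro finite_imageI) (simp add: Lam_def card_box)
  have "inj_on ?t ?A"
    by (intro inj_onI) (simp add: inj_image_eq_iff)
  then have "(\<Sum>\<Delta> \<in> {\<Delta>. finite \<Delta> \<and> i \<in> \<Delta> \<and> max_rate c \<Delta> > 0}. ereal (1 / real (card (\<Delta> \<inter> Lam n))) *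
      (\<Sum>\<xi> \<in> \<Delta> \<rightarrow>\<^sub>E UNIV. flip_term \<nu> \<Delta> \<xi> (Lam n) (\<lambda>\<eta>. c \<Delta> \<eta> \<xi>)))
    = (\<Sum>D \<in> ?A. ereal (1 / real (card (?t D \<inter> Lam n))) *
      (\<Sum>\<xi> \<in> ?t D \<rightarrow>\<^sub>E UNIV. flip_term \<nu> (?t D) \<xi> (Lam n) (\<lambda>\<eta>. c (?t D) \<eta> \<xi>)))"
    by (subst active_sets_translate[OF c(2)]) (simp add: sum.reindex)
  also have "\<dots> = site_term c \<nu> ?W"
    unfolding site_term_def
  proof (rule sum.cong[OF refl], rule arg_cong2[where f = "(*)"])
    fix D assume D: "D \<in> ?A"
    have "?t D \<inter> Lam n = ?t (D \<inter> ?W)"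
      by (subst W) (simp only: image_Int[OF inj_on_add])
    then show "ereal (1 / real (card (?t D \<inter> Lam n))) = ereal (1 / real (card (D \<inter> ?W)))"
      by (simp add: card_image)
    have "(\<Sum>\<xi> \<in> ?t D \<rightarrow>\<^sub>E UNIV. flip_term \<nu> (?t D) \<xi> (Lam n) (\<lambda>\<eta>. c (?t D) \<eta> \<xi>))
      = (\<Sum>\<xi> \<in> D \<rightarrow>\<^sub>E UNIV. flip_term \<nu> (?t D) (shift i \<xi>) (?t ?W) (\<lambda>\<eta>. c (?t D) \<eta> (shift i \<xi>)))"
      unfolding W[symmetric] by (rule sum_shift)
    also have "\<dots> = (\<Sum>\<xi> \<in> D \<rightarrow>\<^sub>E UNIV. flip_term \<nu> D \<xi> ?W (\<lambda>\<eta>. c D \<eta> \<xi>))"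
      by (intro sum.cong refl flip_term_translate[OF \<nu> c _ _ _ fin]) (use D in auto)
    finally show "(\<Sum>\<xi> \<in> ?t D \<rightarrow>\<^sub>E UNIV. flip_term \<nu> (?t D) \<xi> (Lam n) (\<lambda>\<eta>. c (?t D) \<eta> \<xi>)) = \<dots>" .
  qed
  finally show "(\<Sum>\<Delta> \<in> {\<Delta>. finite \<Delta> \<and> i \<in> \<Delta> \<and> max_rate c \<Delta> > 0}. ereal (1 / real (card (\<Delta> \<inter> Lam n))) *
      (\<Sum>\<xi> \<in> \<Delta> \<rightarrow>\<^sub>E UNIV. ereal_integral \<nu> (\<lambda>\<eta>. ereal (c \<Delta> \<eta> \<xi>) *
           elog (cyl_cond_prob \<nu> (\<Delta> \<inter> Lam n) \<xi> (Lam n - \<Delta>) \<eta>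
                 / cyl_cond_prob \<nu> (\<Delta> \<inter> Lam n) \<eta> (Lam n - \<Delta>) \<eta>)))) = site_term c \<nu> ?W"
    unfolding flip_term_def .
qed

text \<open>The last argument of \<open>rate_inf\<close> is the error constant B with the supremum
  of the rate as the bound \<open>K\<close>.\<close>

definition site_limit ::
  "('d::finite, 'q::finite) rates \<Rightarrow> ('d, 'q) config measure \<Rightarrow> ereal" where
  "site_limit c \<nu> = (\<Sum>D \<in> {D. finite D \<and> 0 \<in> D \<and> max_rate c D > 0}.
     ereal (1 / real (card D)) * (\<Sum>\<xi> \<in> D \<rightarrow>\<^sub>E UNIV.
       rate_inf \<nu> D \<xi> (\<lambda>\<eta>. c D \<eta> \<xi>) ((SUP \<eta>. c D \<eta> \<xi>) * card (D \<rightarrow>\<^sub>E (UNIV :: 'q set)))))"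

theorem proposition3p3:
  fixes c :: "('d::finite, 'q::finite) rates"
  assumes "well_defined_ips c"
    and "translation_invariant_rates c"
    and "finitely_many_types c"
    and "uniformly_continuous_rates c"
    and "positive_minimal_rate c"
    and "no_entry_to_traps c"
  shows "(\<forall>\<nu> \<in> inv_measures.
            (\<lambda>n. entropy_loss_density c n \<nu>) \<longlonglongrightarrow> entropy_loss c \<nu> \<and> entropy_loss c \<nu> < \<infinity>)
         \<and> upper_semicontinuous_map weak_topology (entropy_loss c)"
proof -
  let ?A = "{D. finite D \<and> 0 \<in> D \<and> max_rate c D > 0}"
  let ?R = "\<lambda>\<nu> D \<xi>. rate_inf \<nu> D \<xi> (\<lambda>\<eta>. c D \<eta> \<xi>) ((SUP \<eta>. c D \<eta> \<xi>) * card (D \<rightarrow>\<^sub>E (UNIV :: 'q set)))"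
  have ips: "ips_rates c" using assms(1) by (simp add: well_defined_ips_def)
  have squeeze: "\<exists>V s. squeeze (\<lambda>\<eta>. c D \<eta> \<xi>) \<epsilon> V s"
    if "D \<in> ?A" "\<xi> \<in> D \<rightarrow>\<^sub>E UNIV" "0 < \<epsilon>" for D \<xi> \<epsilon>
    using that by (intro ex_squeeze_rates[OF ips assms(4,5)]) auto
  have less: "?R \<nu> D \<xi> < \<infinity>" if "D \<in> ?A" "\<xi> \<in> D \<rightarrow>\<^sub>E UNIV" for \<nu> D \<xi>
  proof -
    from squeeze[OF that zero_less_one] obtain V s where "squeeze (\<lambda>\<eta>. c D \<eta> \<xi>) 1 V s"
      by (elim exE)
    then show ?thesis
      using that(1) by (intro rate_inf_less_PInf[OF _ zero_less_one]) auto
  qed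
  have less': "ereal (1 / real (card D)) * (\<Sum>\<xi> \<in> D \<rightarrow>\<^sub>E UNIV. ?R \<nu> D \<xi>) < \<infinity>"
    if "D \<in> ?A" for \<nu> D
    by (intro ereal_mult_less_PInf sum_ereal_less_PInf less[OF that]) auto
  have lim: "(\<lambda>n. entropy_loss_density c n \<nu>) \<longlonglongrightarrow> site_limit c \<nu>" if \<nu>: "\<nu> \<in> inv_measures" for \<nu>
  proof -
    have flip: "((\<lambda>W. flip_term \<nu> D \<xi> W (\<lambda>\<eta>. c D \<eta> \<xi>)) \<longlongrightarrow> ?R \<nu> D \<xi>) (finite_subsets_at_top UNIV)"
      if D: "D \<in> ?A" and \<xi>: "\<xi> \<in> D \<rightarrow>\<^sub>E UNIV" for D \<xi>
    proof -
      have D': "finite D" "D \<noteq> {}" using D by auto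
      have meas: "(\<lambda>\<eta>. c D \<eta> \<xi>) \<in> borel_measurable config_borel"
        using ips D' \<xi> by (intro continuous_map_config_measurable) (simp add: ips_rates_def)
      have nonneg: "0 \<le> c D \<eta> \<xi>" for \<eta>
        using ips D' \<xi> by (simp add: ips_rates_def)
      \<comment> \<open>Any relative error would do here; the resulting boundedness makes the
        real-valued supremum a genuine upper bound.\<close>
      obtain V s where "squeeze (\<lambda>\<eta>. c D \<eta> \<xi>) 1 V s"
        using squeeze[OF D \<xi> zero_less_one] by (elim exE)
      then have "bdd_above (range (\<lambda>\<eta>. c D \<eta> \<xi>))"
        by (rule squeeze_bdd_above) simp
      then have bound: "c D \<eta> \<xi> \<le> (SUP \<eta>. c D \<eta> \<xi>)" for \<eta>
        by (intro cSUP_upper) auto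
      note \<nu>' = inv_measuresD(1,2)[OF \<nu>]
      \<comment> \<open>The pattern-sum formula is available for windows containing
        \<open>D\<close>, hence eventually.\<close>
      have "\<forall>\<^sub>F W in finite_subsets_at_top UNIV. rate_sum \<nu> D \<xi> W (mean_rate \<nu> (\<lambda>\<eta>. c D \<eta> \<xi>) W)
          = flip_term \<nu> D \<xi> W (\<lambda>\<eta>. c D \<eta> \<xi>)"
        unfolding eventually_finite_subsets_at_top using D'(1)
        by (auto intro!: exI[of _ D] flip_term_eq_rate_sum[OF \<nu>' _ _ meas nonneg bound, symmetric])
      then show ?thesis
        using rate_sum_mean_rate_tendsto[OF \<nu>' D'(1) meas nonneg bound squeeze[OF D \<xi>]]
        by (rule Lim_transform_eventually[rotated])
    qed
    have "(site_term c \<nu> \<longlongrightarrow> site_limit c \<nu>) (finite_subsets_at_top UNIV)"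
      unfolding site_term_def site_limit_def
    proof (rule tendsto_sum_ereal_less_PInf)
      fix D assume D: "D \<in> ?A"
      have "((\<lambda>W. ereal (1 / real (card D)) * (\<Sum>\<xi> \<in> D \<rightarrow>\<^sub>E UNIV. flip_term \<nu> D \<xi> W (\<lambda>\<eta>. c D \<eta> \<xi>)))
        \<longlongrightarrow> ereal (1 / real (card D)) * (\<Sum>\<xi> \<in> D \<rightarrow>\<^sub>E UNIV. ?R \<nu> D \<xi>)) (finite_subsets_at_top UNIV)"
        by (intro tendsto_cmult_ereal tendsto_sum_ereal_less_PInf flip[OF D] less[OF D]) auto
      moreover have "\<forall>\<^sub>F W in finite_subsets_at_top UNIV. D \<subseteq> W"
        unfolding eventually_finite_subsets_at_top using D by auto
      then have "\<forall>\<^sub>F W in finite_subsets_at_top UNIV.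
        ereal (1 / real (card D)) * (\<Sum>\<xi> \<in> D \<rightarrow>\<^sub>E UNIV. flip_term \<nu> D \<xi> W (\<lambda>\<eta>. c D \<eta> \<xi>))
        = ereal (1 / real (card (D \<inter> W))) * (\<Sum>\<xi> \<in> D \<rightarrow>\<^sub>E UNIV. flip_term \<nu> D \<xi> W (\<lambda>\<eta>. c D \<eta> \<xi>))"
        by eventually_elim (simp add: Int_absorb2)
      ultimately show "((\<lambda>W. ereal (1 / real (card (D \<inter> W))) *
          (\<Sum>\<xi> \<in> D \<rightarrow>\<^sub>E UNIV. flip_term \<nu> D \<xi> W (\<lambda>\<eta>. c D \<eta> \<xi>)))
        \<longlongrightarrow> ereal (1 / real (card D)) * (\<Sum>\<xi> \<in> D \<rightarrow>\<^sub>E UNIV. ?R \<nu> D \<xi>)) (finite_subsets_at_top UNIV)"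
        by (rule Lim_transform_eventually)
    qed (rule less')
    then show ?thesis
      unfolding entropy_loss_density_def entropy_loss_approx_eq[OF \<nu> ips assms(2)]
      by (rule box_average_tendsto)
  qed
  then have eq: "entropy_loss c \<nu> = site_limit c \<nu>" if "\<nu> \<in> inv_measures" for \<nu>
    unfolding entropy_loss_def using that by (intro limI)
  have "site_limit c \<nu> < \<infinity>" for \<nu>
    unfolding site_limit_def by (intro sum_ereal_less_PInf less')
  moreover have "upper_semicontinuous_map weak_topology (site_limit c)"
    unfolding site_limit_def
    by (intro usc_sum usc_cmult usc_rate_inf less' less) auto
  \<comment> \<open>\<open>entropy_loss c\<close> is identified with \<open>site_limit c\<close> on
    \<open>inv_measures\<close>, which is the whole space of the weak topology, so the sublevel sets
    coincide.\<close>
  then have "upper_semicontinuous_map weak_topology (entropy_loss c)"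
    by (simp add: upper_semicontinuous_map_def eq cong: conj_cong)
  ultimately show ?thesis
    using lim eq by simp
qed

end
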